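(* Let $\mathbb{F}$ be a field of characteristic $2$ and let $(U,\mu,Q,1)$ be a unital composition algebra in the symmetric tensor category $\mathsf{Ver}_4^+$ over $\mathbb{F}$, with trivial Frobenius twist (equivalently, $\ker t=\operatorname{im} t$), and let $B$ be the bilinear form associated to $Q$. (1) If $\dim U=2$, then there is an element $v\in U$ such that $t(v)=1$ and $v^2=\lambda 1$ for some $\lambda\in\mathbb{F}$. The bilinear form satisfies $B(v,v)=B(v,1)=1$ and $B(1,1)=0$. Denote by $U(\lambda)$ this algebra (basis $(1,v)$, identity $1$, $v^2=\lambda 1$, $t(1)=0$, $t(v)=1$, and $B$ as given). The algebras $U(\lambda)$ and $U(\lambda')$ are isomorphic (as algebras in $\mathsf{Ver}_4^+$) if and only if $\lambda'-\lambda\in\mathbb{F}^2$. (2) If $\dim U=4$, then there are an element $v\in U$ such that $t(v)=1$ and $v^2=\lambda 1$ for some $\lambda\in\mathbb{F}$, and an element $x\in\operatorname{im} t$ with $B(v,x)=0$, such that $(1,v,x,vx)$ is a basis of $U$ and, for some $0\neq \nu\in\mathbb{F}$, the multiplication is given by the following table (the entry in row $a$ and column $b$ is the product $ab$): \[ \begin{array}{c|cccc} & 1 & v & x & vx\\ \hline 1 & 1 & v & x & vx\\ v & v & \lambda 1 & vx & (\lambda+1)x\\ x & x & x+vx & \nu 1 & \nu(v+1)\\ vx & vx & \lambda x+vx & \nu v & \nu v+(\lambda+1)\nu 1 \end{array} \] The bilinear form is given by $B(v,v)=B(v,1)=1$, $B(vx,vx)=B(vx,x)=\nu$, and all the other values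 of $B$ on pairs of basis elements are either $0$ or obtained from these by the symmetry of $B$. Denote by $U(\lambda,\nu)$ this algebra (with $t(1)=0$, $t(v)=1$, $t(x)=0$, $t(vx)=x$). The algebras $U(\lambda,\nu)$ and $U(\lambda',\nu')$ are isomorphic (as algebras in $\mathsf{Ver}_4^+$) if and only if $\lambda'-\lambda\in\mathbb{F}^2$ and $\nu'\nu^{-1}\in(\mathbb{F}^\times)^2$.
   Context: Let $\mathbb{F}$ be a field of characteristic $2$. $\mathsf{Ver}_4^+$ is the symmetric tensor category of finite-dimensional modules over the Hopf algebra $\mathbb{F}[t]=\mathbb{F}1\oplus\mathbb{F}t$, $t^2=0$, with $t$ primitive (so $t(u\otimes v)=t(u)\otimes v+u\otimes t(v)$ on tensor products, and $t$ acts as $0$ on the unit object $\mathbb{F}$), with braiding $c_{U,V}(u\otimes v)=v\otimes u+t(v)\otimes t(u)$. Morphisms are linear maps commuting with $t$. Here $\ker t$ and $\operatorname{im} t$ are the kernel and image of the action of $t$ on $U$. An algebra $(U,\mu)$ in $\mathsf{Ver}_4^+$ is an object with a morphism $\mu:U\otimes U\to U$, $\mu(u\otimes v)=uv$ (not necessarily associative); thus $t$ acts as a derivation. It is unital, written $(U,\mu,1)$, if there is a morphism $\mathbb{F}\to U$ sending the unit of $\mathbb{F}$ to an element $1$ with $1u=u=u1$ for all $u$. Isomorphisms of algebras in $\mathsf{Ver}_4^+$ are multiplicative linear bijections commuting with $t$. Let $\Gamma^2(U)=\ker(\mathrm{id}-c_{U,U})\subseteq U\otimes U$. A quadratic form on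 $U$ is a morphism $Q:\Gamma^2(U)\to\mathbb{F}$. Its associated bilinear form is $B(u,v)=Q\bigl(u\otimes v+v\otimes u+t(v)\otimes t(u)\bigr)$, which is symmetric; $Q$ is nondegenerate if $B$ is nondegenerate. The multiplication $\hat\mu$ on $U\otimes U$ is $(\mu\otimes\mu)\circ(\mathrm{id}\otimes c_{U,U}\otimes\mathrm{id})$, i.e. $(a\otimes b)(c\otimes d)=ac\otimes bd+a\,t(c)\otimes t(b)\,d$; it restricts to a multiplication $\tilde\mu$ on $\Gamma^2(U)$. $Q$ is multiplicative if $Q\circ\tilde\mu=Q\otimes Q$ on $\Gamma^2(U)\otimes\Gamma^2(U)$. A unital composition algebra $(U,\mu,Q,1)$ in $\mathsf{Ver}_4^+$ is a unital algebra with a nondegenerate multiplicative quadratic form $Q$. The Frobenius twist $U^{(1)}$ is the image of the composition $\Gamma^2(U)\hookrightarrow U\otimes U\twoheadrightarrow S^2(U)=\operatorname{coker}(\mathrm{id}-c_{U,U})$; it is known that $U^{(1)}=0$ if and only if $\ker t=\operatorname{im} t$. $\mathbb{F}^2$ denotes the set of squares of elements of $\mathbb{F}$ and $(\mathbb{F}^\times)^2$ the set of squares of nonzero elements. *)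

theory Defs
  imports "HOL-Analysis.Cartesian_Space" "HOL-Library.Function_Algebras"
begin

section \<open>Objects and morphisms\<close>

text \<open>An object is carried by a whole type, with its own scalar multiplication and its own action
  of \<open>t\<close>.\<close>

record ('f, 'u) ver4_obj =
  scal :: "'f \<Rightarrow> 'u \<Rightarrow> 'u"
  tact :: "'u \<Rightarrow> 'u"

definition ver4_object :: "('f::field, 'u::ab_group_add, 'm) ver4_obj_scheme \<Rightarrow> bool" where
  "ver4_object U \<longleftrightarrow>
     (\<exists>Basis. finite_dimensional_vector_space (scal U) Basis) \<and>
     Vector_Spaces.linear (scal U) (scal U) (tact U) \<and>
     (\<forall>u. tact U (tact U u) = 0)"

text \<open>The sources \<open>U \<otimes> U\<close> and \<open>\<Gamma>\<^sup>2(U)\<close> of the morphisms below are proper subspaces of their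
  carrier types, so the source of a morphism is a set \<open>S\<close>; values off \<open>S\<close> are irrelevant.\<close>

definition ver4_hom_on ::
  "'u set \<Rightarrow> ('f, 'u::plus, 'm) ver4_obj_scheme \<Rightarrow> ('f, 'w::plus, 'n) ver4_obj_scheme \<Rightarrow> ('u \<Rightarrow> 'w) \<Rightarrow> bool"
  where "ver4_hom_on S V W f \<longleftrightarrow>
     (\<forall>x\<in>S. \<forall>y\<in>S. f (x + y) = f x + f y) \<and>
     (\<forall>c. \<forall>x\<in>S. f (scal V c x) = scal W c (f x)) \<and>
     (\<forall>x\<in>S. f (tact V x) = tact W (f x))"

definition unit_object :: "('f::field, 'f) ver4_obj" where
  "unit_object = \<lparr>scal = (*), tact = (\<lambda>_. 0)\<rparr>"

definition is_basis :: "('f::field, 'u::ab_group_add, 'm) ver4_obj_scheme \<Rightarrow> 'u list \<Rightarrow> bool" where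
  "is_basis U bs \<longleftrightarrow> distinct bs \<and> \<not> module.dependent (scal U) (set bs) \<and>
     module.span (scal U) (set bs) = UNIV"


section \<open>The tensor square\<close>

text \<open>A tensor is represented by the functional it induces on bilinear forms on \<open>U\<close>:
  \<open>u \<otimes> v\<close> is the evaluation \<open>\<beta> \<mapsto> \<beta> u v\<close> (set to 0 if \<open>\<beta>\<close> is not bilinear), and \<open>U \<otimes> U\<close>
  is the span of these.  The lemma \<open>tensor_universal\<close> below is the universal property.\<close>

type_synonym ('f, 'u) tensor = "('u \<Rightarrow> 'u \<Rightarrow> 'f) \<Rightarrow> 'f"

definition bilinear_map ::
  "('f::field \<Rightarrow> 'u \<Rightarrow> 'u) \<Rightarrow> ('f \<Rightarrow> 'w \<Rightarrow> 'w) \<Rightarrow> ('u::ab_group_add \<Rightarrow> 'u \<Rightarrow> 'w::ab_group_add) \<Rightarrow> bool"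
  where "bilinear_map s r b \<longleftrightarrow>
     (\<forall>u. Vector_Spaces.linear s r (\<lambda>v. b u v)) \<and> (\<forall>v. Vector_Spaces.linear s r (\<lambda>u. b u v))"

definition pure_tensor ::
  "'u \<Rightarrow> ('f::field, 'u::ab_group_add, 'm) ver4_obj_scheme \<Rightarrow> 'u \<Rightarrow> ('f, 'u) tensor"
  ("_ \<otimes>\<^bsub>_\<^esub> _" [71, 0, 71] 70)
  where "u \<otimes>\<^bsub>U\<^esub> v = (\<lambda>\<beta>. if bilinear_map (scal U) (*) \<beta> then \<beta> u v else 0)"

definition tensor_scale :: "'f::times \<Rightarrow> ('f, 'u) tensor \<Rightarrow> ('f, 'u) tensor" where
  "tensor_scale c X = (\<lambda>\<beta>. c * X \<beta>)"

definition tensor_space :: "('f::field, 'u::ab_group_add, 'm) ver4_obj_scheme \<Rightarrow> ('f, 'u) tensor set" where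
  "tensor_space U = module.span tensor_scale {u \<otimes>\<^bsub>U\<^esub> v | u v. True}"

text \<open>The linear extension to \<open>U \<otimes> U\<close> of a bilinear map \<open>b\<close> with values in \<open>U \<otimes> U\<close>;
  see \<open>tensor_lift_pure\<close>.\<close>

definition tensor_lift :: "('u \<Rightarrow> 'u \<Rightarrow> ('f, 'u) tensor) \<Rightarrow> ('f, 'u) tensor \<Rightarrow> ('f, 'u) tensor" where
  "tensor_lift b X = (\<lambda>\<beta>. X (\<lambda>u v. b u v \<beta>))"

definition braid :: "('f::field, 'u::ab_group_add, 'm) ver4_obj_scheme \<Rightarrow> ('f, 'u) tensor \<Rightarrow> ('f, 'u) tensor" where
  "braid U = tensor_lift (\<lambda>u v. v \<otimes>\<^bsub>U\<^esub> u + tact U v \<otimes>\<^bsub>U\<^esub> tact U u)"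

definition tensor_object :: "('f::field, 'u::ab_group_add, 'm) ver4_obj_scheme \<Rightarrow> ('f, ('f, 'u) tensor) ver4_obj" where
  "tensor_object U = \<lparr>scal = tensor_scale,
     tact = tensor_lift (\<lambda>u v. tact U u \<otimes>\<^bsub>U\<^esub> v + u \<otimes>\<^bsub>U\<^esub> tact U v)\<rparr>"

definition Gamma2 :: "('f::field, 'u::ab_group_add, 'm) ver4_obj_scheme \<Rightarrow> ('f, 'u) tensor set" where
  "Gamma2 U = {X \<in> tensor_space U. X - braid U X = 0}"

text \<open>The canonical projection \<open>U \<otimes> U \<rightarrow> S\<^sup>2(U)\<close>; elements of \<open>S\<^sup>2(U)\<close> are cosets of the image
  of \<open>id - c\<close>.\<close>

definition sym2_proj :: "('f::field, 'u::ab_group_add, 'm) ver4_obj_scheme \<Rightarrow> ('f, 'u) tensor \<Rightarrow> ('f, 'u) tensor set" where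
  "sym2_proj U X = {X + (Y - braid U Y) | Y. Y \<in> tensor_space U}"

definition frobenius_twist :: "('f::field, 'u::ab_group_add, 'm) ver4_obj_scheme \<Rightarrow> ('f, 'u) tensor set set" where
  "frobenius_twist U = sym2_proj U ` Gamma2 U"

definition trivial_frobenius_twist :: "('f::field, 'u::ab_group_add, 'm) ver4_obj_scheme \<Rightarrow> bool" where
  "trivial_frobenius_twist U \<longleftrightarrow> frobenius_twist U = {sym2_proj U 0}"


section \<open>Algebras and composition algebras\<close>

record ('f, 'u) ver4_alg = "('f, 'u) ver4_obj" +
  mult :: "('f, 'u) tensor \<Rightarrow> 'u"

definition ver4_algebra :: "('f::field, 'u::ab_group_add, 'm) ver4_alg_scheme \<Rightarrow> bool" where
  "ver4_algebra A \<longleftrightarrow> ver4_object A \<and> ver4_hom_on (tensor_space A) (tensor_object A) A (mult A)"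

definition alg_prod :: "'u \<Rightarrow> ('f::field, 'u::ab_group_add, 'm) ver4_alg_scheme \<Rightarrow> 'u \<Rightarrow> 'u"
  ("_ \<odot>\<^bsub>_\<^esub> _" [71, 0, 71] 70)
  where "u \<odot>\<^bsub>A\<^esub> v = mult A (u \<otimes>\<^bsub>A\<^esub> v)"

definition is_unit :: "('f::field, 'u::ab_group_add, 'm) ver4_alg_scheme \<Rightarrow> 'u \<Rightarrow> bool" where
  "is_unit A e \<longleftrightarrow> (\<exists>\<eta>. ver4_hom_on UNIV unit_object A \<eta> \<and> \<eta> 1 = e) \<and>
     (\<forall>u. e \<odot>\<^bsub>A\<^esub> u = u \<and> u \<odot>\<^bsub>A\<^esub> e = u)"

definition tensor_mult ::
  "('f::field, 'u::ab_group_add, 'm) ver4_alg_scheme \<Rightarrow> ('f, 'u) tensor \<Rightarrow> ('f, 'u) tensor \<Rightarrow> ('f, 'u) tensor"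
  where "tensor_mult A X Y =
     tensor_lift (\<lambda>a b. tensor_lift (\<lambda>c d.
       (a \<odot>\<^bsub>A\<^esub> c) \<otimes>\<^bsub>A\<^esub> (b \<odot>\<^bsub>A\<^esub> d) +
       (a \<odot>\<^bsub>A\<^esub> tact A c) \<otimes>\<^bsub>A\<^esub> (tact A b \<odot>\<^bsub>A\<^esub> d)) Y) X"

definition quadratic_form ::
  "('f::field, 'u::ab_group_add, 'm) ver4_obj_scheme \<Rightarrow> (('f, 'u) tensor \<Rightarrow> 'f) \<Rightarrow> bool" where
  "quadratic_form U Q \<longleftrightarrow> ver4_hom_on (Gamma2 U) (tensor_object U) unit_object Q"

definition assoc_bilinear ::
  "('f::field, 'u::ab_group_add, 'm) ver4_obj_scheme \<Rightarrow> (('f, 'u) tensor \<Rightarrow> 'f) \<Rightarrow> 'u \<Rightarrow> 'u \<Rightarrow> 'f" where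
  "assoc_bilinear U Q u v = Q (u \<otimes>\<^bsub>U\<^esub> v + v \<otimes>\<^bsub>U\<^esub> u + tact U v \<otimes>\<^bsub>U\<^esub> tact U u)"

definition nondegenerate ::
  "('f::field, 'u::ab_group_add, 'm) ver4_obj_scheme \<Rightarrow> (('f, 'u) tensor \<Rightarrow> 'f) \<Rightarrow> bool" where
  "nondegenerate U Q \<longleftrightarrow> (\<forall>u. (\<forall>v. assoc_bilinear U Q u v = 0) \<longrightarrow> u = 0)"

definition multiplicative_form ::
  "('f::field, 'u::ab_group_add, 'm) ver4_alg_scheme \<Rightarrow> (('f, 'u) tensor \<Rightarrow> 'f) \<Rightarrow> bool" where
  "multiplicative_form A Q \<longleftrightarrow> (\<forall>X\<in>Gamma2 A. \<forall>Y\<in>Gamma2 A. Q (tensor_mult A X Y) = Q X * Q Y)"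

definition unital_composition_algebra ::
  "('f::field, 'u::ab_group_add, 'm) ver4_alg_scheme \<Rightarrow> (('f, 'u) tensor \<Rightarrow> 'f) \<Rightarrow> 'u \<Rightarrow> bool" where
  "unital_composition_algebra A Q e \<longleftrightarrow> ver4_algebra A \<and> is_unit A e \<and>
     quadratic_form A Q \<and> nondegenerate A Q \<and> multiplicative_form A Q"

definition alg_iso ::
  "('f::field, 'u::ab_group_add, 'm) ver4_alg_scheme \<Rightarrow> ('f, 'w::ab_group_add, 'n) ver4_alg_scheme \<Rightarrow> ('u \<Rightarrow> 'w) \<Rightarrow> bool"
  where "alg_iso A A' \<phi> \<longleftrightarrow> bij \<phi> \<and> ver4_hom_on UNIV A A' \<phi> \<and>
     (\<forall>u v. \<phi> (u \<odot>\<^bsub>A\<^esub> v) = \<phi> u \<odot>\<^bsub>A'\<^esub> \<phi> v)"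

definition isomorphic ::
  "('f::field, 'u::ab_group_add, 'm) ver4_alg_scheme \<Rightarrow> ('f, 'w::ab_group_add, 'n) ver4_alg_scheme \<Rightarrow> bool"
  where "isomorphic A A' \<longleftrightarrow> (\<exists>\<phi>. alg_iso A A' \<phi>)"


section \<open>The algebras \<open>U(\<lambda>)\<close> and \<open>U(\<lambda>,\<nu>)\<close>\<close>

text \<open>The multiplication on \<open>F\<^sup>n\<close> whose product of the \<open>i\<close>-th and \<open>j\<close>-th standard basis vectors
  is \<open>T $ i $ j\<close>; the arguments of \<open>X\<close> are the coordinates of the bilinear product, see
  \<open>prod_alg_two\<close> and \<open>prod_alg_four\<close>.\<close>

definition table_mult :: "'f::field ^ 'n ^ 'n ^ 'n \<Rightarrow> ('f, 'f ^ 'n) tensor \<Rightarrow> 'f ^ 'n" where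
  "table_mult T X = (\<chi> k. X (\<lambda>u v. \<Sum>i\<in>UNIV. \<Sum>j\<in>UNIV. u $ i * v $ j * T $ i $ j $ k))"

text \<open>Coordinates with respect to \<open>(1, v)\<close>.\<close>

definition alg_two :: "'f::field \<Rightarrow> ('f, 'f ^ 2) ver4_alg" where
  "alg_two lam = \<lparr>scal = (*s), tact = (\<lambda>u. vector [u $ 2, 0]),
     mult = table_mult (vector
       [vector [vector [1, 0], vector [0, 1]],
        vector [vector [0, 1], vector [lam, 0]]])\<rparr>"

text \<open>Coordinates with respect to \<open>(1, v, x, vx)\<close>.\<close>

definition alg_four :: "'f::field \<Rightarrow> 'f \<Rightarrow> ('f, 'f ^ 4) ver4_alg" where
  "alg_four lam nu = \<lparr>scal = (*s), tact = (\<lambda>u. vector [u $ 2, 0, u $ 4, 0]),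
     mult = table_mult (vector
       [vector [vector [1, 0, 0, 0], vector [0, 1, 0, 0], vector [0, 0, 1, 0], vector [0, 0, 0, 1]],
        vector [vector [0, 1, 0, 0], vector [lam, 0, 0, 0], vector [0, 0, 0, 1], vector [0, 0, lam + 1, 0]],
        vector [vector [0, 0, 1, 0], vector [0, 0, 1, 1], vector [nu, 0, 0, 0], vector [nu, nu, 0, 0]],
        vector [vector [0, 0, 0, 1], vector [0, 0, lam, 1], vector [0, nu, 0, 0],
                vector [(lam + 1) * nu, nu, 0, 0]]])\<rparr>"


section \<open>Basic facts about the encoding\<close>

lemma vector_space_tensor_scale: "vector_space (tensor_scale :: 'f::field \<Rightarrow> _ \<Rightarrow> ('f, 'u) tensor)"
  by unfold_locales (auto simp: tensor_scale_def fun_eq_iff algebra_simps)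

lemma vector_space_field: "vector_space ((*) :: 'f::field \<Rightarrow> 'f \<Rightarrow> 'f)"
  by unfold_locales (auto simp: algebra_simps)

lemma linear_eval:
  "Vector_Spaces.linear tensor_scale (*) (\<lambda>X :: ('f::field, 'u) tensor. X \<beta>)"
  by (simp add: Vector_Spaces.linear_iff vector_space_tensor_scale vector_space_field) (simp add: tensor_scale_def)

lemma linear_tensor_lift:
  "Vector_Spaces.linear tensor_scale tensor_scale
     (tensor_lift b :: ('f::field, 'u) tensor \<Rightarrow> ('f, 'u) tensor)"
  by (simp add: Vector_Spaces.linear_iff vector_space_tensor_scale) (simp add: tensor_scale_def tensor_lift_def fun_eq_iff)

lemma bilinear_map_alt:
  "bilinear_map s r b \<longleftrightarrow> vector_space s \<and> vector_space r \<and>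
     (\<forall>u x y. b u (x + y) = b u x + b u y) \<and> (\<forall>u c x. b u (s c x) = r c (b u x)) \<and>
     (\<forall>v x y. b (x + y) v = b x v + b y v) \<and> (\<forall>v c x. b (s c x) v = r c (b x v))"
  unfolding bilinear_map_def Vector_Spaces.linear_iff by blast

lemma bilinear_pure_tensor:
  assumes "vector_space (scal U)"
  shows "bilinear_map (scal U) tensor_scale (\<lambda>u v. u \<otimes>\<^bsub>U\<^esub> v)"
  unfolding bilinear_map_alt
  using assms vector_space_tensor_scale
  by (auto simp: bilinear_map_alt pure_tensor_def tensor_scale_def fun_eq_iff)

lemma tensor_lift_pure:
  assumes "bilinear_map (scal U) tensor_scale b"
  shows "tensor_lift b (u \<otimes>\<^bsub>U\<^esub> v) = b u v"
proof -
  have "bilinear_map (scal U) (*) (\<lambda>u v. b u v \<beta>)" for \<beta>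
    using assms vector_space_field
    by (auto simp: bilinear_map_alt tensor_scale_def)
  then show ?thesis
    by (auto simp: tensor_lift_def pure_tensor_def fun_eq_iff)
qed

lemma bilinear_map_add:
  assumes "bilinear_map s r b" "bilinear_map s r b'"
  shows "bilinear_map s r (\<lambda>u v. b u v + b' u v)"
proof -
  interpret vector_space r using assms(1) by (simp add: bilinear_map_alt)
  show ?thesis
    using assms by (simp add: bilinear_map_alt scale_right_distrib)
qed

lemma bilinear_map_comp:
  assumes "bilinear_map s r b" "Vector_Spaces.linear s s f" "Vector_Spaces.linear s s g"
  shows "bilinear_map s r (\<lambda>u v. b (f u) (g v))" and "bilinear_map s r (\<lambda>u v. b (f v) (g u))"
  using assms by (simp_all add: bilinear_map_alt Vector_Spaces.linear_iff)

lemma ver4_objectD: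
  assumes "ver4_object U"
  shows "vector_space (scal U)" and "Vector_Spaces.linear (scal U) (scal U) (tact U)"
    and "Vector_Spaces.linear (scal U) (scal U) (\<lambda>u. u)"
  using assms by (auto simp: ver4_object_def Vector_Spaces.linear_iff)

lemma braid_pure:
  assumes "ver4_object U"
  shows "braid U (u \<otimes>\<^bsub>U\<^esub> v) = v \<otimes>\<^bsub>U\<^esub> u + tact U v \<otimes>\<^bsub>U\<^esub> tact U u"
  unfolding braid_def
  by (rule tensor_lift_pure)
    (intro bilinear_map_add bilinear_map_comp(2)[OF bilinear_pure_tensor] ver4_objectD[OF assms])

lemma tact_pure:
  assumes "ver4_object U"
  shows "tact (tensor_object U) (u \<otimes>\<^bsub>U\<^esub> v) = tact U u \<otimes>\<^bsub>U\<^esub> v + u \<otimes>\<^bsub>U\<^esub> tact U v"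
proof -
  have "bilinear_map (scal U) tensor_scale (\<lambda>u v. tact U u \<otimes>\<^bsub>U\<^esub> v + u \<otimes>\<^bsub>U\<^esub> tact U v)"
    by (intro bilinear_map_add bilinear_map_comp(1)[OF bilinear_pure_tensor] ver4_objectD[OF assms])
  from tensor_lift_pure[OF this] show ?thesis
    by (simp add: tensor_object_def)
qed

lemma bilinear_alg_prod:
  assumes "ver4_algebra A"
  shows "bilinear_map (scal A) (scal A) (\<lambda>u v. u \<odot>\<^bsub>A\<^esub> v)"
proof -
  have O: "ver4_object A" and h: "ver4_hom_on (tensor_space A) (tensor_object A) A (mult A)"
    using assms by (auto simp: ver4_algebra_def)
  interpret T: vector_space "tensor_scale :: 'a \<Rightarrow> ('a, 'b) tensor \<Rightarrow> _"
    by (rule vector_space_tensor_scale)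
  have "u \<otimes>\<^bsub>A\<^esub> v \<in> tensor_space A" for u v
    unfolding tensor_space_def by (rule T.span_base) blast
  then show ?thesis
    using bilinear_pure_tensor[OF ver4_objectD(1)[OF O]] h ver4_objectD(1)[OF O]
    by (simp add: bilinear_map_alt alg_prod_def ver4_hom_on_def tensor_object_def)
qed

lemma tensor_mult_pure:
  assumes "ver4_algebra A"
  shows "tensor_mult A (a \<otimes>\<^bsub>A\<^esub> b) (c \<otimes>\<^bsub>A\<^esub> d) =
    (a \<odot>\<^bsub>A\<^esub> c) \<otimes>\<^bsub>A\<^esub> (b \<odot>\<^bsub>A\<^esub> d) + (a \<odot>\<^bsub>A\<^esub> tact A c) \<otimes>\<^bsub>A\<^esub> (tact A b \<odot>\<^bsub>A\<^esub> d)"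
proof -
  have O: "ver4_object A" using assms by (simp add: ver4_algebra_def)
  note bp = bilinear_pure_tensor[OF ver4_objectD(1)[OF O]]
  note facts = bilinear_alg_prod[OF assms] ver4_objectD[OF O]
  let ?f = "\<lambda>a b c d. (a \<odot>\<^bsub>A\<^esub> c) \<otimes>\<^bsub>A\<^esub> (b \<odot>\<^bsub>A\<^esub> d) +
    (a \<odot>\<^bsub>A\<^esub> tact A c) \<otimes>\<^bsub>A\<^esub> (tact A b \<odot>\<^bsub>A\<^esub> d)"
  have 1: "bilinear_map (scal A) tensor_scale (?f a b)" for a b
    by (intro bilinear_map_add bilinear_map_comp(1)[OF bp])
      (use facts in \<open>simp_all add: bilinear_map_alt Vector_Spaces.linear_iff\<close>)
  have 2: "bilinear_map (scal A) tensor_scale (\<lambda>a b. ?f a b c d)" for c d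
    by (intro bilinear_map_add bilinear_map_comp(1)[OF bp])
      (use facts in \<open>simp_all add: bilinear_map_alt Vector_Spaces.linear_iff\<close>)
  have "tensor_mult A (a \<otimes>\<^bsub>A\<^esub> b) (c \<otimes>\<^bsub>A\<^esub> d) =
      tensor_lift (\<lambda>a b. ?f a b c d) (a \<otimes>\<^bsub>A\<^esub> b)"
    unfolding tensor_mult_def by (simp add: tensor_lift_pure[OF 1])
  also have "\<dots> = ?f a b c d" by (rule tensor_lift_pure[OF 2])
  finally show ?thesis .
qed

lemma tensor_hom_unique:
  fixes U :: "('f::field, 'u::ab_group_add, 'm) ver4_obj_scheme" and r :: "'f \<Rightarrow> 'w::ab_group_add \<Rightarrow> 'w"
  assumes "Vector_Spaces.linear tensor_scale r \<phi>" "Vector_Spaces.linear tensor_scale r \<psi>"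
    and eq: "\<And>u v. \<phi> (u \<otimes>\<^bsub>U\<^esub> v) = \<psi> (u \<otimes>\<^bsub>U\<^esub> v)"
    and X: "X \<in> tensor_space U"
  shows "\<phi> X = \<psi> X"
proof -
  interpret vector_space_pair "tensor_scale :: 'f \<Rightarrow> ('f, 'u) tensor \<Rightarrow> _" r
    using assms(1) by (simp add: vector_space_pair_def Vector_Spaces.linear_iff)
  show ?thesis
  proof (rule linear_eq_on[OF assms(1,2) X[unfolded tensor_space_def]])
    fix Y assume "Y \<in> {u \<otimes>\<^bsub>U\<^esub> v | u v. True}"
    then obtain u v where "Y = u \<otimes>\<^bsub>U\<^esub> v" by blast
    then show "\<phi> Y = \<psi> Y" using eq by (simp only:)
  qed
qed

text \<open>The linear map below is unique on \<open>U \<otimes> U\<close> by \<open>tensor_hom_unique\<close>.\<close>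

theorem tensor_universal:
  fixes U :: "('f::field, 'u::ab_group_add, 'm) ver4_obj_scheme" and r :: "'f \<Rightarrow> 'w::ab_group_add \<Rightarrow> 'w"
  assumes b: "bilinear_map (scal U) r b"
  shows "\<exists>\<phi>. Vector_Spaces.linear tensor_scale r \<phi> \<and> (\<forall>u v. \<phi> (u \<otimes>\<^bsub>U\<^esub> v) = b u v)"
proof -
  have V: "vector_space (scal U)" and W: "vector_space r" using b by (simp_all add: bilinear_map_alt)
  interpret V: vector_space "scal U" by (rule V)
  interpret W: vector_space r by (rule W)
  interpret T: vector_space "tensor_scale :: 'f \<Rightarrow> ('f, 'u) tensor \<Rightarrow> _"
    by (rule vector_space_tensor_scale)
  interpret TW: vector_space_pair "tensor_scale :: 'f \<Rightarrow> ('f, 'u) tensor \<Rightarrow> _" r ..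
  interpret VW: vector_space_pair "scal U" r ..
  note bp = bilinear_pure_tensor[OF V]
  obtain B where B: "V.independent B" "V.span B = UNIV"
    using V.independent_extend_basis[OF V.independent_empty] V.span_extend_basis[OF V.independent_empty]
    by blast
  define co where "co i u = V.representation B u i" for i u
  have co_add: "co i (u + u') = co i u + co i u'" and co_scale: "co i (scal U c u) = c * co i u" for i u u' c
    unfolding co_def using B by (simp_all add: V.representation_add V.representation_scale)
  have co_B: "i \<in> B \<Longrightarrow> j \<in> B \<Longrightarrow> co i j = (if i = j then 1 else 0)" for i j
    unfolding co_def using B by (simp add: V.representation_basis)
  define ev where "ev i j = (\<lambda>X :: ('f, 'u) tensor. X (\<lambda>u v. co i u * co j v))" for i j
  have bil: "bilinear_map (scal U) (*) (\<lambda>u v. co i u * co j v)" for i j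
    using V vector_space_field by (simp add: bilinear_map_alt co_add co_scale algebra_simps)
  have ev: "ev i j (u \<otimes>\<^bsub>U\<^esub> v) = co i u * co j v" for i j u v
    by (simp add: ev_def pure_tensor_def bil)
  have lin_ev: "Vector_Spaces.linear tensor_scale (*) (ev i j)" for i j
    unfolding ev_def by (rule linear_eval)
  define g where "g = (\<lambda>(i, j). i \<otimes>\<^bsub>U\<^esub> j)"
  have inj: "inj_on g (B \<times> B)"
  proof (rule inj_onI, clarify)
    fix i j k l assume *: "i \<in> B" "j \<in> B" "k \<in> B" "l \<in> B" "g (i, j) = g (k, l)"
    then have "ev i j (g (k, l)) = 1" by (simp flip: *(5)) (simp add: g_def ev co_B)
    then show "i = k \<and> j = l" using * by (auto simp: g_def ev co_B split: if_splits)
  qed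
  have ind: "T.independent (g ` (B \<times> B))"
  proof
    assume "T.dependent (g ` (B \<times> B))"
    then obtain i j where ij: "i \<in> B" "j \<in> B" "g (i, j) \<in> T.span (g ` (B \<times> B) - {g (i, j)})"
      unfolding T.dependent_def by blast
    interpret E: Vector_Spaces.linear tensor_scale "(*)" "ev i j" by (rule lin_ev)
    have "ev i j (g (i, j)) = 0"
    proof (rule E.eq_0_on_span[OF _ ij(3)])
      fix x assume "x \<in> g ` (B \<times> B) - {g (i, j)}"
      then show "ev i j x = 0" using ij by (auto simp: g_def ev co_B)
    qed
    then show False using ij by (simp add: g_def ev co_B)
  qed
  obtain \<phi> where \<phi>: "Vector_Spaces.linear tensor_scale r \<phi>"
    "\<forall>x \<in> g ` (B \<times> B). \<phi> x = case_prod b (the_inv_into (B \<times> B) g x)"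
    using TW.linear_independent_extend[OF ind, of "\<lambda>x. case_prod b (the_inv_into (B \<times> B) g x)"] by auto
  have \<phi>B: "\<phi> (i \<otimes>\<^bsub>U\<^esub> j) = b i j" if "i \<in> B" "j \<in> B" for i j
  proof -
    have "the_inv_into (B \<times> B) g (g (i, j)) = (i, j)" using that by (simp add: the_inv_into_f_f inj)
    moreover have "g (i, j) \<in> g ` (B \<times> B)" using that by blast
    ultimately have "\<phi> (g (i, j)) = b i j" using \<phi>(2) by force
    then show ?thesis by (simp add: g_def)
  qed
  have bp': "Vector_Spaces.linear (scal U) tensor_scale (\<lambda>v. u \<otimes>\<^bsub>U\<^esub> v)"
    "Vector_Spaces.linear (scal U) tensor_scale (\<lambda>u. u \<otimes>\<^bsub>U\<^esub> v)" for u v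
    using bp unfolding bilinear_map_def by blast+
  have l1: "Vector_Spaces.linear (scal U) r (\<lambda>v. \<phi> (u \<otimes>\<^bsub>U\<^esub> v))"
    and l2: "Vector_Spaces.linear (scal U) r (\<lambda>u. \<phi> (u \<otimes>\<^bsub>U\<^esub> v))" for u v
    using Vector_Spaces.linear_compose[OF bp'(1) \<phi>(1)] Vector_Spaces.linear_compose[OF bp'(2) \<phi>(1)]
    by (simp_all add: comp_def)
  have l3: "Vector_Spaces.linear (scal U) r (\<lambda>v. b u v)"
    and l4: "Vector_Spaces.linear (scal U) r (\<lambda>u. b u v)" for u v
    using b unfolding bilinear_map_def by blast+
  have all: "x \<in> V.span B" for x using B by simp
  have \<phi>B1: "\<phi> (i \<otimes>\<^bsub>U\<^esub> v) = b i v" if "i \<in> B" for i v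
    by (rule VW.linear_eq_on[OF l1[of i] l3[of i] all[of v]]) (rule \<phi>B[OF that])
  have "\<phi> (u \<otimes>\<^bsub>U\<^esub> v) = b u v" for u v
    by (rule VW.linear_eq_on[OF l2[of v] l4[of v] all[of u]]) (rule \<phi>B1)
  with \<phi>(1) show "\<exists>\<phi>. Vector_Spaces.linear tensor_scale r \<phi> \<and> (\<forall>u v. \<phi> (u \<otimes>\<^bsub>U\<^esub> v) = b u v)"
    by blast
qed

lemma table_mult_pure:
  assumes "scal U = (*s)"
  shows "table_mult T (u \<otimes>\<^bsub>U\<^esub> v) = (\<chi> k. \<Sum>i\<in>UNIV. \<Sum>j\<in>UNIV. u $ i * v $ j * T $ i $ j $ k)"
proof -
  have "bilinear_map (*s) (*) (\<lambda>u v. \<Sum>i\<in>UNIV. \<Sum>j\<in>UNIV. u $ i * v $ j * T $ i $ j $ k)" for k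
    using vec.vector_space_axioms vector_space_field
    by (simp add: bilinear_map_alt algebra_simps sum.distrib sum_distrib_left)
  then show ?thesis
    by (simp add: table_mult_def pure_tensor_def assms)
qed

lemma vector_4 [simp]:
  "(vector [a, b, c, d] :: 'a::zero ^ 4) $ 1 = a"
  "(vector [a, b, c, d] :: 'a::zero ^ 4) $ 2 = b"
  "(vector [a, b, c, d] :: 'a::zero ^ 4) $ 3 = c"
  "(vector [a, b, c, d] :: 'a::zero ^ 4) $ 4 = d"
  unfolding vector_def by simp_all

lemma prod_alg_two:
  "vector [a, b] \<odot>\<^bsub>alg_two lam\<^esub> vector [c, d] = vector [a * c + lam * (b * d), a * d + b * c]"
  by (simp add: alg_prod_def table_mult_pure alg_two_def vec_eq_iff forall_2 sum_2 algebra_simps)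

lemma prod_alg_four:
  "u \<odot>\<^bsub>alg_four lam nu\<^esub> v = vector [
     u $ 1 * v $ 1 + lam * (u $ 2 * v $ 2) + nu * (u $ 3 * v $ 3 + u $ 3 * v $ 4 + (lam + 1) * (u $ 4 * v $ 4)),
     u $ 1 * v $ 2 + u $ 2 * v $ 1 + nu * (u $ 3 * v $ 4 + u $ 4 * v $ 3 + u $ 4 * v $ 4),
     u $ 1 * v $ 3 + u $ 3 * v $ 1 + u $ 3 * v $ 2 + (lam + 1) * (u $ 2 * v $ 4) + lam * (u $ 4 * v $ 2),
     u $ 1 * v $ 4 + u $ 4 * v $ 1 + u $ 2 * v $ 3 + u $ 3 * v $ 2 + u $ 4 * v $ 2]"
  by (simp add: alg_prod_def table_mult_pure alg_four_def vec_eq_iff forall_4 sum_4 algebra_simps)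

lemma ver4_algebra_table:
  fixes A :: "('f::field, 'f ^ 'n) ver4_alg"
  assumes A: "scal A = (*s)" "mult A = table_mult T"
    and t: "Vector_Spaces.linear (*s) (*s) (tact A)" "\<And>u. tact A (tact A u) = 0"
    and der: "\<And>u v. tact A (u \<odot>\<^bsub>A\<^esub> v) = tact A u \<odot>\<^bsub>A\<^esub> v + u \<odot>\<^bsub>A\<^esub> tact A v"
  shows "ver4_algebra A"
proof -
  have O: "ver4_object A"
    using A(1) t vec.finite_dimensional_vector_space_axioms by (auto simp: ver4_object_def)
  interpret TW: vector_space_pair "tensor_scale :: 'f \<Rightarrow> ('f, 'f ^ 'n) tensor \<Rightarrow> _" "(*s)"
    by (intro vector_space_pair.intro vector_space_tensor_scale vec.vector_space_axioms)
  have lin: "Vector_Spaces.linear tensor_scale (*s) (mult A)"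
    using vector_space_tensor_scale vec.vector_space_axioms
    by (simp add: Vector_Spaces.linear_iff A) (simp add: table_mult_def vec_eq_iff tensor_scale_def)
  have lt: "Vector_Spaces.linear tensor_scale tensor_scale (tact (tensor_object A))"
    by (simp add: tensor_object_def linear_tensor_lift)
  have l1: "Vector_Spaces.linear tensor_scale (*s) (\<lambda>X. mult A (tact (tensor_object A) X))"
    and l2: "Vector_Spaces.linear tensor_scale (*s) (\<lambda>X. tact A (mult A X))"
    using lin lt t(1) by (simp_all add: Vector_Spaces.linear_iff)
  have "mult A (tact (tensor_object A) X) = tact A (mult A X)" if "X \<in> tensor_space A" for X
  proof (rule TW.linear_eq_on[OF l1 l2 that[unfolded tensor_space_def]])
    fix Y assume "Y \<in> {u \<otimes>\<^bsub>A\<^esub> v | u v. True}"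
    then obtain u v where Y: "Y = u \<otimes>\<^bsub>A\<^esub> v" by blast
    have "mult A (x + y) = mult A x + mult A y" for x y using lin by (simp add: Vector_Spaces.linear_iff)
    then show "mult A (tact (tensor_object A) Y) = tact A (mult A Y)"
      using der[of u v] by (simp add: Y tact_pure[OF O] alg_prod_def)
  qed
  then show ?thesis
    using O lin by (simp add: ver4_algebra_def ver4_hom_on_def Vector_Spaces.linear_iff tensor_object_def A(1))
qed

lemma two_eq_0:
  assumes "CHAR('f::field) = 2"
  shows "(2::'f) = 0" "a + a = (0::'f)" "a + (a + b) = (b::'f)"
proof -
  show *: "(2::'f) = 0" using of_nat_CHAR[where ?'a='f] assms by simp
  show **: "a + a = 0" for a :: 'f by (metis * mult_2 mult_zero_left)
  show "a + (a + b) = b" by (metis ** add.assoc add_0)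
qed

lemma ver4_algebra_alg_two:
  assumes "CHAR('f::field) = 2"
  shows "ver4_algebra (alg_two (lam :: 'f))"
proof (rule ver4_algebra_table)
  show "scal (alg_two lam) = (*s)" by (simp add: alg_two_def)
  show "mult (alg_two lam) = table_mult (vector
       [vector [vector [1, 0], vector [0, 1]], vector [vector [0, 1], vector [lam, 0]]])"
    by (simp add: alg_two_def)
  show "Vector_Spaces.linear (*s) (*s) (tact (alg_two lam))"
    using vec.vector_space_axioms by (simp add: Vector_Spaces.linear_iff alg_two_def vec_eq_iff forall_2)
  show "tact (alg_two lam) (tact (alg_two lam) u) = 0" for u
    by (simp add: alg_two_def vec_eq_iff forall_2)
  show "tact (alg_two lam) (u \<odot>\<^bsub>alg_two lam\<^esub> v) =
    tact (alg_two lam) u \<odot>\<^bsub>alg_two lam\<^esub> v + u \<odot>\<^bsub>alg_two lam\<^esub> tact (alg_two lam) v" for u v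
    by (simp add: alg_prod_def table_mult_pure alg_two_def vec_eq_iff forall_2 sum_2 algebra_simps
        two_eq_0[OF assms])
qed

lemma ver4_algebra_alg_four:
  assumes "CHAR('f::field) = 2"
  shows "ver4_algebra (alg_four (lam :: 'f) nu)"
proof (rule ver4_algebra_table)
  let ?A = "alg_four lam nu"
  show "scal ?A = (*s)" by (simp add: alg_four_def)
  show "mult ?A = table_mult (vector
       [vector [vector [1, 0, 0, 0], vector [0, 1, 0, 0], vector [0, 0, 1, 0], vector [0, 0, 0, 1]],
        vector [vector [0, 1, 0, 0], vector [lam, 0, 0, 0], vector [0, 0, 0, 1], vector [0, 0, lam + 1, 0]],
        vector [vector [0, 0, 1, 0], vector [0, 0, 1, 1], vector [nu, 0, 0, 0], vector [nu, nu, 0, 0]],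
        vector [vector [0, 0, 0, 1], vector [0, 0, lam, 1], vector [0, nu, 0, 0],
                vector [(lam + 1) * nu, nu, 0, 0]]])"
    by (simp add: alg_four_def)
  show "Vector_Spaces.linear (*s) (*s) (tact ?A)"
    using vec.vector_space_axioms by (simp add: Vector_Spaces.linear_iff alg_four_def vec_eq_iff forall_4)
  have ta: "tact ?A u = vector [u $ 2, 0, u $ 4, 0]" for u by (simp add: alg_four_def)
  show "tact ?A (tact ?A u) = 0" for u
    by (simp add: ta vec_eq_iff forall_4)
  show "tact ?A (u \<odot>\<^bsub>?A\<^esub> v) = tact ?A u \<odot>\<^bsub>?A\<^esub> v + u \<odot>\<^bsub>?A\<^esub> tact ?A v" for u v
    by (simp add: prod_alg_four ta vec_eq_iff forall_4 algebra_simps two_eq_0[OF assms])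
qed

end

theory Submission
  imports Defs
begin

text \<open>If \<open>u\<close> is in \<open>ker t\<close> but not in \<open>im t\<close>, and \<open>f\<close> is a functional with \<open>f u = 1\<close> that vanishes on
  \<open>im t\<close>, then \<open>f \<otimes> f\<close> kills the image of \<open>id - c\<close> but not \<open>u \<otimes> u\<close>; so a trivial Frobenius twist forces
  \<open>ker t = im t\<close>.  Evaluating multiplicativity of \<open>Q\<close> on the tensors \<open>(id + c)(u \<otimes> v)\<close> gives a linearized
  composition law for \<open>B\<close>.  Moving all factors to one side by adjointness and cancelling by
  nondegeneracy gives an identity in the algebra which, with \<open>t v = 1\<close> and \<open>x\<close> in \<open>ker t\<close> orthogonal
  to \<open>v\<close>, yields every entry of the multiplication table.\<close>

section \<open>The associated bilinear form\<close>

text \<open>This is (id + c)(u \<otimes> v). In characteristic 2 such tensors span the image of id -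
  c, so B records exactly the restriction of Q to that image.\<close>

definition symmetrized_tensor ::
  "('f::field, 'u::ab_group_add, 'm) ver4_obj_scheme \<Rightarrow> 'u \<Rightarrow> 'u \<Rightarrow> ('f, 'u) tensor" where
  "symmetrized_tensor U u v = u \<otimes>\<^bsub>U\<^esub> v + v \<otimes>\<^bsub>U\<^esub> u + tact U v \<otimes>\<^bsub>U\<^esub> tact U u"

section \<open>Linear algebra of the tensor square in characteristic 2\<close>

lemma assoc_bilinear_eq: "assoc_bilinear U Q u v = Q (symmetrized_tensor U u v)"
  by (simp add: assoc_bilinear_def symmetrized_tensor_def)

lemma pure_in_tensor_space:
  fixes U :: "('f::field, 'u::ab_group_add, 'm) ver4_obj_scheme"
  shows "u \<otimes>\<^bsub>U\<^esub> v \<in> tensor_space U"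
proof -
  interpret T: vector_space "tensor_scale :: 'f \<Rightarrow> ('f, 'u) tensor \<Rightarrow> _"
    by (rule vector_space_tensor_scale)
  show ?thesis unfolding tensor_space_def by (rule T.span_base) blast
qed

lemma tensor_space_add:
  fixes U :: "('f::field, 'u::ab_group_add, 'm) ver4_obj_scheme"
  shows "X \<in> tensor_space U \<Longrightarrow> Y \<in> tensor_space U \<Longrightarrow> X + Y \<in> tensor_space U"
proof -
  interpret T: vector_space "tensor_scale :: 'f \<Rightarrow> ('f, 'u) tensor \<Rightarrow> _"
    by (rule vector_space_tensor_scale)
  show "X \<in> tensor_space U \<Longrightarrow> Y \<in> tensor_space U \<Longrightarrow> X + Y \<in> tensor_space U"
    unfolding tensor_space_def by (rule T.span_add)
qed

lemma tensor_lift_add: "tensor_lift b (X + Y) = tensor_lift b X + tensor_lift b Y"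
  by (simp add: tensor_lift_def fun_eq_iff)

lemma braid_add: "braid U (X + Y) = braid U X + braid U Y"
  by (simp add: braid_def tensor_lift_add)

lemma tact_tensor_add:
  "tact (tensor_object U) (X + Y) = tact (tensor_object U) X + tact (tensor_object U) Y"
  by (simp add: tensor_object_def tensor_lift_add)

lemma tensor_mult_add_left: "tensor_mult A (X + X') Y = tensor_mult A X Y + tensor_mult A X' Y"
  by (simp add: tensor_mult_def tensor_lift_add)

lemma Gamma2_add: "X \<in> Gamma2 U \<Longrightarrow> Y \<in> Gamma2 U \<Longrightarrow> X + Y \<in> Gamma2 U"
  by (simp add: Gamma2_def tensor_space_add braid_add add_diff_add)

lemma tensor_add_self:
  assumes "CHAR('f::field) = 2"
  shows "X + X = (0 :: ('f, 'u) tensor)" "X + (X + Y) = (Y :: ('f, 'u) tensor)"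
  by (simp_all add: fun_eq_iff two_eq_0[OF assms])

lemma ver4_object_tact:
  assumes "ver4_object U"
  shows "tact U (u + v) = tact U u + tact U v" "tact U (scal U c u) = scal U c (tact U u)"
    "tact U 0 = 0" "tact U (tact U u) = 0"
proof -
  show 1: "tact U (u + v) = tact U u + tact U v" for u v
    using assms by (simp add: ver4_object_def Vector_Spaces.linear_iff)
  show "tact U (scal U c u) = scal U c (tact U u)" "tact U (tact U u) = 0"
    using assms by (simp_all add: ver4_object_def Vector_Spaces.linear_iff)
  show "tact U 0 = 0" using 1[of 0 0] by simp
qed

lemma pure_tensor_bilinear:
  assumes "vector_space (scal U)"
  shows "(u + u') \<otimes>\<^bsub>U\<^esub> v = u \<otimes>\<^bsub>U\<^esub> v + u' \<otimes>\<^bsub>U\<^esub> v"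
    "u \<otimes>\<^bsub>U\<^esub> (v + v') = u \<otimes>\<^bsub>U\<^esub> v + u \<otimes>\<^bsub>U\<^esub> v'"
    "scal U c u \<otimes>\<^bsub>U\<^esub> v = tensor_scale c (u \<otimes>\<^bsub>U\<^esub> v)"
    "u \<otimes>\<^bsub>U\<^esub> scal U c v = tensor_scale c (u \<otimes>\<^bsub>U\<^esub> v)"
    "0 \<otimes>\<^bsub>U\<^esub> v = 0" "u \<otimes>\<^bsub>U\<^esub> 0 = 0"
proof -
  have *: "bilinear_map (scal U) tensor_scale (\<lambda>u v. u \<otimes>\<^bsub>U\<^esub> v)"
    by (rule bilinear_pure_tensor[OF assms])
  show 1: "(u + u') \<otimes>\<^bsub>U\<^esub> v = u \<otimes>\<^bsub>U\<^esub> v + u' \<otimes>\<^bsub>U\<^esub> v"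
    and 2: "u \<otimes>\<^bsub>U\<^esub> (v + v') = u \<otimes>\<^bsub>U\<^esub> v + u \<otimes>\<^bsub>U\<^esub> v'"
    and "scal U c u \<otimes>\<^bsub>U\<^esub> v = tensor_scale c (u \<otimes>\<^bsub>U\<^esub> v)"
    and "u \<otimes>\<^bsub>U\<^esub> scal U c v = tensor_scale c (u \<otimes>\<^bsub>U\<^esub> v)" for u u' v v'
    using * unfolding bilinear_map_alt by blast+
  show "0 \<otimes>\<^bsub>U\<^esub> v = 0" using 1[of 0 0 v] by simp
  show "u \<otimes>\<^bsub>U\<^esub> 0 = 0" using 2[of u 0 0] by simp
qed

text \<open>Since t^2 = 0, applying c twice sends u \<otimes> v to u \<otimes> v + 2 t(u) \<otimes>
  t(v). Hence c is an involution in characteristic 2 and id - c kills the image of id + c.\<close>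

lemma symmetrized_tensor_in_Gamma2:
  assumes "CHAR('f::field) = 2" and "ver4_object (U :: ('f, 'u::ab_group_add, 'm) ver4_obj_scheme)"
  shows "symmetrized_tensor U u v \<in> Gamma2 U"
proof -
  have "braid U (symmetrized_tensor U u v) = symmetrized_tensor U u v"
    by (simp add: symmetrized_tensor_def braid_add braid_pure[OF assms(2)] ver4_object_tact[OF assms(2)]
        pure_tensor_bilinear[OF ver4_objectD(1)[OF assms(2)]] tensor_add_self[OF assms(1)] add_ac)
  then show ?thesis
    by (simp add: Gamma2_def symmetrized_tensor_def tensor_space_add pure_in_tensor_space)
qed

section \<open>Bilinearity, t-equivariance and products of symmetrized tensors\<close>

lemma symmetrized_tensor_add:
  assumes "ver4_object U"
  shows "symmetrized_tensor U (u + u') v = symmetrized_tensor U u v + symmetrized_tensor U u' v"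
    and "symmetrized_tensor U u (v + v') = symmetrized_tensor U u v + symmetrized_tensor U u v'"
  by (simp_all add: symmetrized_tensor_def ver4_object_tact[OF assms] add_ac
      pure_tensor_bilinear[OF ver4_objectD(1)[OF assms]])

lemma symmetrized_tensor_scale:
  fixes U :: "('f::field, 'u::ab_group_add, 'm) ver4_obj_scheme"
  assumes "ver4_object U"
  shows "symmetrized_tensor U (scal U c u) v = tensor_scale c (symmetrized_tensor U u v)"
    and "symmetrized_tensor U u (scal U c v) = tensor_scale c (symmetrized_tensor U u v)"
proof -
  have "tensor_scale c (X + Y) = tensor_scale c X + tensor_scale c Y" for X Y :: "('f, 'u) tensor"
    by (simp add: tensor_scale_def fun_eq_iff algebra_simps)
  then show "symmetrized_tensor U (scal U c u) v = tensor_scale c (symmetrized_tensor U u v)"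
    and "symmetrized_tensor U u (scal U c v) = tensor_scale c (symmetrized_tensor U u v)"
    by (simp_all add: symmetrized_tensor_def ver4_object_tact[OF assms]
      pure_tensor_bilinear[OF ver4_objectD(1)[OF assms]])
qed

lemma tact_symmetrized_tensor:
  assumes "ver4_object U"
  shows "tact (tensor_object U) (symmetrized_tensor U u v) =
    symmetrized_tensor U (tact U u) v + symmetrized_tensor U u (tact U v)"
  by (simp add: symmetrized_tensor_def tact_tensor_add tact_pure[OF assms] ver4_object_tact[OF assms]
      pure_tensor_bilinear[OF ver4_objectD(1)[OF assms]] add_ac)

text \<open>Additivity of \<open>tensor_mult\<close> in the first argument is immediate from the
  outer lift. A sum in the second argument sits under that lift; it can be split once the outer
  tensor is pure, because the lift is then evaluated at a bilinear map.\<close>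

lemma tensor_mult_pure_symmetrized:
  assumes A: "ver4_algebra A"
  shows "tensor_mult A (a \<otimes>\<^bsub>A\<^esub> b) (symmetrized_tensor A c d) =
    tensor_mult A (a \<otimes>\<^bsub>A\<^esub> b) (c \<otimes>\<^bsub>A\<^esub> d) + tensor_mult A (a \<otimes>\<^bsub>A\<^esub> b) (d \<otimes>\<^bsub>A\<^esub> c) +
    tensor_mult A (a \<otimes>\<^bsub>A\<^esub> b) (tact A d \<otimes>\<^bsub>A\<^esub> tact A c)"
proof -
  have O: "ver4_object A" using A by (simp add: ver4_algebra_def)
  note bp = bilinear_pure_tensor[OF ver4_objectD(1)[OF O]]
  note facts = bilinear_alg_prod[OF A] ver4_objectD[OF O]
  let ?f = "\<lambda>a b c d. (a \<odot>\<^bsub>A\<^esub> c) \<otimes>\<^bsub>A\<^esub> (b \<odot>\<^bsub>A\<^esub> d) +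
    (a \<odot>\<^bsub>A\<^esub> tact A c) \<otimes>\<^bsub>A\<^esub> (tact A b \<odot>\<^bsub>A\<^esub> d)"
  have 1: "bilinear_map (scal A) tensor_scale (?f a b)" for a b
    by (intro bilinear_map_add bilinear_map_comp(1)[OF bp])
      (use facts in \<open>simp_all add: bilinear_map_alt Vector_Spaces.linear_iff\<close>)
  have 2: "bilinear_map (scal A) tensor_scale (\<lambda>a b. ?f a b c d)" for c d
    by (intro bilinear_map_add bilinear_map_comp(1)[OF bp])
      (use facts in \<open>simp_all add: bilinear_map_alt Vector_Spaces.linear_iff\<close>)
  have "tensor_mult A (a \<otimes>\<^bsub>A\<^esub> b) (symmetrized_tensor A c d) =
    tensor_lift (\<lambda>a b. ?f a b c d + ?f a b d c + ?f a b (tact A d) (tact A c)) (a \<otimes>\<^bsub>A\<^esub> b)"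
    unfolding tensor_mult_def symmetrized_tensor_def tensor_lift_add tensor_lift_pure[OF 1] ..
  also have "\<dots> = ?f a b c d + ?f a b d c + ?f a b (tact A d) (tact A c)"
    by (rule tensor_lift_pure) (intro bilinear_map_add 2)
  finally show ?thesis by (simp only: tensor_mult_pure[OF A])
qed

lemma ver4_algebra_tact_prod:
  assumes "ver4_algebra A"
  shows "tact A (u \<odot>\<^bsub>A\<^esub> v) = tact A u \<odot>\<^bsub>A\<^esub> v + u \<odot>\<^bsub>A\<^esub> tact A v"
proof -
  have O: "ver4_object A" using assms by (simp add: ver4_algebra_def)
  have "tact A (u \<odot>\<^bsub>A\<^esub> v) = mult A (tact (tensor_object A) (u \<otimes>\<^bsub>A\<^esub> v))"
    using assms pure_in_tensor_space[of u A v] by (simp add: ver4_algebra_def ver4_hom_on_def alg_prod_def)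
  also have "\<dots> = tact A u \<odot>\<^bsub>A\<^esub> v + u \<odot>\<^bsub>A\<^esub> tact A v"
    using assms pure_in_tensor_space[of _ A]
    by (simp add: tact_pure[OF O] ver4_algebra_def ver4_hom_on_def alg_prod_def)
  finally show ?thesis .
qed

text \<open>After expansion, the Leibniz rule, t^2 = 0 and characteristic 2 regroup the pure tensors
  into symmetrized ones. Applying Q to such a product therefore yields values of B only.\<close>

lemma tensor_mult_symmetrized:
  assumes F: "CHAR('f::field) = 2" and A: "ver4_algebra (A :: ('f, 'u::ab_group_add, 'm) ver4_alg_scheme)"
  shows "tensor_mult A (symmetrized_tensor A a b) (symmetrized_tensor A c d) =
    symmetrized_tensor A (a \<odot>\<^bsub>A\<^esub> c) (b \<odot>\<^bsub>A\<^esub> d) +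
    symmetrized_tensor A (a \<odot>\<^bsub>A\<^esub> tact A c) (tact A b \<odot>\<^bsub>A\<^esub> d) +
    symmetrized_tensor A (a \<odot>\<^bsub>A\<^esub> d) (b \<odot>\<^bsub>A\<^esub> c) +
    symmetrized_tensor A (a \<odot>\<^bsub>A\<^esub> tact A d) (tact A b \<odot>\<^bsub>A\<^esub> c) +
    symmetrized_tensor A (a \<odot>\<^bsub>A\<^esub> tact A d) (b \<odot>\<^bsub>A\<^esub> tact A c)"
proof -
  have O: "ver4_object A" using A by (simp add: ver4_algebra_def)
  have z: "0 \<odot>\<^bsub>A\<^esub> u = 0" "u \<odot>\<^bsub>A\<^esub> 0 = 0" for u
  proof -
    have "(0 + 0) \<odot>\<^bsub>A\<^esub> u = 0 \<odot>\<^bsub>A\<^esub> u + 0 \<odot>\<^bsub>A\<^esub> u" "u \<odot>\<^bsub>A\<^esub> (0 + 0) = u \<odot>\<^bsub>A\<^esub> 0 + u \<odot>\<^bsub>A\<^esub> 0"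
      using bilinear_alg_prod[OF A] unfolding bilinear_map_alt by blast+
    then show "0 \<odot>\<^bsub>A\<^esub> u = 0" "u \<odot>\<^bsub>A\<^esub> 0 = 0" by simp_all
  qed
  have "tensor_mult A (symmetrized_tensor A a b) (symmetrized_tensor A c d) =
     tensor_mult A (a \<otimes>\<^bsub>A\<^esub> b) (symmetrized_tensor A c d) +
     tensor_mult A (b \<otimes>\<^bsub>A\<^esub> a) (symmetrized_tensor A c d) +
     tensor_mult A (tact A b \<otimes>\<^bsub>A\<^esub> tact A a) (symmetrized_tensor A c d)"
    by (simp add: symmetrized_tensor_def[of A a b] tensor_mult_add_left)
  then show ?thesis
    unfolding tensor_mult_pure_symmetrized[OF A]
    by (simp add: tensor_mult_pure[OF A] symmetrized_tensor_def
        ver4_algebra_tact_prod[OF A] ver4_object_tact[OF O] z pure_tensor_bilinear[OF ver4_objectD(1)[OF O]]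
        tensor_add_self[OF F] add_ac)
qed

section \<open>From the Frobenius twist to ker t = im t\<close>

lemma trivial_frobenius_twist_kernel:
  fixes U :: "('f::field, 'u::ab_group_add, 'm) ver4_obj_scheme"
  assumes O: "ver4_object U" and tw: "trivial_frobenius_twist U" and u: "tact U u = 0"
  shows "u \<in> range (tact U)"
proof (rule ccontr)
  assume not: "u \<notin> range (tact U)"
  note vs = ver4_objectD(1)[OF O]
  interpret V: vector_space "scal U" by (rule vs)
  interpret F: vector_space "(*) :: 'f \<Rightarrow> 'f \<Rightarrow> 'f" by (rule vector_space_field)
  interpret VF: vector_space_pair "scal U" "(*) :: 'f \<Rightarrow> 'f \<Rightarrow> 'f" ..
  interpret t: Vector_Spaces.linear "scal U" "scal U" "tact U" by (rule ver4_objectD(2)[OF O])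
  have sub: "V.subspace (range (tact U))" by (rule t.subspace_image) (rule V.subspace_UNIV)
  obtain C where C: "C \<subseteq> range (tact U)" "V.independent C" "V.span C = range (tact U)"
    using V.basis_exists[of "range (tact U)"] V.span_subspace[OF _ _ sub] by metis
  have ind: "V.independent (insert u C)" using C not by (simp add: V.independent_insert)
  have uC: "u \<notin> C" using C not by blast
  obtain f where f: "Vector_Spaces.linear (scal U) (*) f" "\<forall>x\<in>insert u C. f x = (if x = u then 1 else 0)"
    using VF.linear_independent_extend[OF ind, of "\<lambda>x. if x = u then 1 else 0"] by blast
  interpret f: Vector_Spaces.linear "scal U" "(*)" f by (rule f(1))
  have ft: "f (tact U w) = 0" for w
    by (rule f.eq_0_on_span[of C]) (use f(2) uC C(3) in auto)
  \<comment> \<open>Tensors are functionals on bilinear forms, so evaluating one at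
    \<open>ff\<close> amounts to applying f \<otimes> f.\<close>
  define ff where "ff = (\<lambda>v w. f v * f w)"
  have bil: "bilinear_map (scal U) (*) ff"
    using vs vector_space_field by (simp add: bilinear_map_alt ff_def f.add f.scale algebra_simps)
  have pure: "(v \<otimes>\<^bsub>U\<^esub> w) ff = f v * f w" for v w
    by (simp add: pure_tensor_def bil) (simp add: ff_def)
  \<comment> \<open>The braiding adds t(w) \<otimes> t(v) to the flip, and f \<otimes> f kills this
    term.\<close>
  have inv: "braid U Y ff = Y ff" if "Y \<in> tensor_space U" for Y
  proof (rule tensor_hom_unique[OF _ linear_eval _ that])
    show "Vector_Spaces.linear tensor_scale (*) (\<lambda>Y. braid U Y ff)"
      using Vector_Spaces.linear_compose[OF linear_tensor_lift linear_eval]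
      by (simp add: comp_def braid_def)
    show "braid U (v \<otimes>\<^bsub>U\<^esub> w) ff = (v \<otimes>\<^bsub>U\<^esub> w) ff" for v w
      by (simp add: braid_pure[OF O] pure ft)
  qed
  have "u \<otimes>\<^bsub>U\<^esub> u \<in> Gamma2 U"
    by (simp add: Gamma2_def pure_in_tensor_space braid_pure[OF O] u pure_tensor_bilinear[OF vs])
  then have "sym2_proj U (u \<otimes>\<^bsub>U\<^esub> u) = sym2_proj U 0"
    using tw unfolding trivial_frobenius_twist_def frobenius_twist_def by blast
  moreover have "u \<otimes>\<^bsub>U\<^esub> u \<in> sym2_proj U (u \<otimes>\<^bsub>U\<^esub> u)"
  proof -
    interpret T: vector_space "tensor_scale :: 'f \<Rightarrow> ('f, 'u) tensor \<Rightarrow> _"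
      by (rule vector_space_tensor_scale)
    have "0 \<in> tensor_space U" unfolding tensor_space_def by (rule T.span_zero)
    moreover have "braid U 0 = 0" using braid_add[of U 0 0] by simp
    ultimately show ?thesis
      unfolding sym2_proj_def by (intro CollectI exI[of _ 0]) simp
  qed
  ultimately obtain Y where Y: "Y \<in> tensor_space U" "u \<otimes>\<^bsub>U\<^esub> u = 0 + (Y - braid U Y)"
    unfolding sym2_proj_def by blast
  have "(u \<otimes>\<^bsub>U\<^esub> u) ff = 0" unfolding Y(2) using inv[OF Y(1)] by simp
  moreover have "f u = 1" using f(2) by simp
  ultimately show False by (simp add: pure)
qed


section \<open>Composition algebras with trivial Frobenius twist\<close>

text \<open>Tensors and Q are replaced by B alone. \<open>B_t\<close> comes from Q being a morphism
  to the trivial object, \<open>kernel\<close> from the trivial twist, and \<open>B_mul\<close> from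
  multiplicativity; for t = 0 the latter reads n(a,b) n(c,d) = n(ac,bd) + n(ad,bc), the full
  linearization of n(ab) = n(a) n(b).\<close>

locale twist_free_composition_algebra = finite_dimensional_vector_space s Basis
  for s :: "'f::field \<Rightarrow> 'u::ab_group_add \<Rightarrow> 'u" and Basis +
  fixes t :: "'u \<Rightarrow> 'u" and mul :: "'u \<Rightarrow> 'u \<Rightarrow> 'u" (infixl "\<cdot>" 75)
    and e :: 'u and B :: "'u \<Rightarrow> 'u \<Rightarrow> 'f"
  assumes char2: "CHAR('f) = 2"
    and t_add: "t (u + v) = t u + t v" and t_scale: "t (s k u) = s k (t u)"
    and t_t: "t (t u) = 0" and kernel: "t u = 0 \<Longrightarrow> u \<in> range t"
    and mul_add: "(u + u') \<cdot> v = u \<cdot> v + u' \<cdot> v" "u \<cdot> (v + v') = u \<cdot> v + u \<cdot> v'"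
    and mul_scale: "s k u \<cdot> v = s k (u \<cdot> v)" "u \<cdot> s k v = s k (u \<cdot> v)"
    and t_mul: "t (u \<cdot> v) = t u \<cdot> v + u \<cdot> t v"
    and unit: "e \<cdot> u = u" "u \<cdot> e = u"
    and B_add: "B (u + u') v = B u v + B u' v" and B_scale: "B (s k u) v = k * B u v"
    and B_sym: "B u v = B v u" and B_t: "B (t u) v = B u (t v)"
    and B_nondeg: "(\<And>v. B u v = 0) \<Longrightarrow> u = 0"
    and B_mul: "B a b * B c d = B (a \<cdot> c) (b \<cdot> d) + B (a \<cdot> t c) (t b \<cdot> d) +
      B (a \<cdot> d) (b \<cdot> c) + B (a \<cdot> t d) (t b \<cdot> c) + B (a \<cdot> t d) (b \<cdot> t c)"
begin

section \<open>Elementary rules for addition, multiplication and B\<close>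

lemma add_self: "u + u = (0::'u)" "u + (u + v) = (v::'u)"
proof -
  have *: "u + u = 0" for u :: 'u
    using scale_left_distrib[of 1 1 u] two_eq_0(2)[OF char2, of 1] by simp
  show "u + u = 0" by (rule *)
  show "u + (u + v) = v" using *[of u] by (simp flip: add.assoc)
qed

lemma eq_iff_add_eq_0: "u = (v::'u) \<longleftrightarrow> u + v = 0"
  by (metis add_self add_0_right)

lemma add_eq_iff: "u + w = z \<longleftrightarrow> u = z + (w::'u)"
  by (auto simp: add.assoc add_self)

lemma mul_zero: "0 \<cdot> u = 0" "u \<cdot> 0 = 0"
  using mul_add(1)[of 0 0 u] mul_add(2)[of u 0 0] by simp_all

lemma B_zero: "B 0 v = 0" "B v 0 = 0"
  using B_scale[of 0 0 v] B_sym[of v 0] by simp_all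

lemma B_right: "B u (v + v') = B u v + B u v'" "B u (s k v) = k * B u v"
  using B_add B_scale B_sym by metis+

lemma t_unit: "t e = 0"
  using t_mul[of e e] by (simp add: unit add_self)

text \<open>Both arguments are values of t, and B(t(a), t(b)) = B(a, t(t(b))) = 0, so ker t is
  totally isotropic.\<close>

lemma B_kernel: "t a = 0 \<Longrightarrow> t b = 0 \<Longrightarrow> B a b = 0"
  using kernel[of a] kernel[of b] by (auto simp: B_t t_t B_zero)

lemma B_eqI: "(\<And>a. B a u = B a v) \<Longrightarrow> u = v"
  using B_nondeg[of "u - v"] B_right(1)[of _ "u - v" v] B_sym by simp

text \<open>Put d = e in \<open>B_mul\<close>. For t = 0 this is the classical fact that the adjoint
  of right multiplication by c is right multiplication by the conjugate B(c,e)e - c; the product of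
  t(b) and t(c) is the deformation.\<close>

lemma B_mul_adjoint: "B (a \<cdot> c) b = B a (s (B c e) b + b \<cdot> c + t b \<cdot> t c)"
proof -
  \<comment> \<open>Elements of ker t come first: they pair to 0 with e, so right multiplication by
    them is self-adjoint. This then moves \<open>t c\<close> across in the one mixed term of the
    general case.\<close>
  have tt: "B (a \<cdot> c) b = B a (b \<cdot> c)" if "t c = 0" for a b c
    using B_mul[of a b c e] that two_eq_0[OF char2]
    by (simp add: unit t_unit mul_zero B_zero B_kernel) (metis two_eq_0(2)[OF char2] add_left_cancel)
  have "B a b * B c e = B (a \<cdot> c) b + B a (t b \<cdot> t c) + B a (b \<cdot> c)"
    using B_mul[of a b c e] tt[of "t c" a "t b"] by (simp add: unit t_unit t_t mul_zero B_zero)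
  then have "B (a \<cdot> c) b = B a b * B c e + (B a (t b \<cdot> t c) + B a (b \<cdot> c))"
    by (simp add: add_ac two_eq_0[OF char2])
  then show ?thesis by (simp add: B_right algebra_simps)
qed

text \<open>The linearized form of \<open>(b \<cdot> c\<^sup>*) \<cdot> c = N(c) b\<close> for composition algebras, deformed by \<open>t\<close>.\<close>

lemma mul_right_linearized:
  "b \<cdot> d \<cdot> c + b \<cdot> c \<cdot> d + s (B c e) (b \<cdot> d) + s (B d e) (b \<cdot> c) + b \<cdot> t d \<cdot> t c = s (B c d) b"
proof (rule B_eqI)
  fix a
  \<comment> \<open>Adjointness applied to the factors \<open>t c\<close> and \<open>t d\<close>
    produces the coefficients \<open>B (t c) e\<close> and \<open>B (t d) e\<close>, which
    vanish.\<close>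
  have "B (t u) e = 0" for u by (simp add: B_t t_unit B_zero)
  then show "B a (b \<cdot> d \<cdot> c + b \<cdot> c \<cdot> d + s (B c e) (b \<cdot> d) + s (B d e) (b \<cdot> c) + b \<cdot> t d \<cdot> t c) =
    B a (s (B c d) b)"
    using B_mul[of a b c d]
    by (simp add: B_mul_adjoint B_right B_zero t_mul t_t mul_zero mul_add two_eq_0[OF char2]
        algebra_simps)
qed

section \<open>The unit and its preimages under t\<close>

lemma unit_nonzero: "dim UNIV \<noteq> 0 \<Longrightarrow> e \<noteq> 0"
proof
  assume "e = 0"
  then have "u = 0" for u :: 'u using unit(1)[of u] by (simp add: mul_zero)
  then have "(UNIV :: 'u set) \<subseteq> {0}" by auto
  moreover assume "dim UNIV \<noteq> 0"
  ultimately show False using dim_le_card[of UNIV "{}"] by simp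
qed

text \<open>For c = d = w the terms on the left of the linearized identity cancel in pairs, except
  the deformation term. Thus right multiplication by an element of im t squares to a scalar.\<close>

lemma kernel_mul_twice:
  assumes "t w = x"
  shows "b \<cdot> x \<cdot> x = s (B w w) b"
  using mul_right_linearized[of b w w] assms by (simp add: add_self)

context
  fixes v
  assumes v: "t v = e" and e0: "e \<noteq> 0"
begin

text \<open>Since e = t(v), multiplying by e twice scales by B(v,v), yet it is the identity.\<close>

lemma B_v_v: "B v v = 1"
proof -
  have "s (B v v) e = s 1 e" using kernel_mul_twice[OF v, of e] by (simp add: unit)
  then show ?thesis using e0 by (simp only: scale_cancel_right) simp
qed

lemma t_v_sq: "t (v \<cdot> v) = 0"
  by (simp add: t_mul v unit add_self)

text \<open>In \<open>B_mul\<close> at e, v, v, e the terms other than B(v,v) vanish or pair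
  elements of ker t. Hence B(v,e)^2 = 1, and squaring is injective in characteristic 2.\<close>

lemma B_v_e: "B v e = 1"
proof -
  have "B e v * B v e = 1"
    using B_mul[of e v v e]
    by (simp add: unit v t_unit mul_zero B_zero B_v_v B_kernel t_v_sq)
  then have "(B v e + 1)\<^sup>2 = 0"
    by (simp add: B_sym[of e] power2_eq_square algebra_simps two_eq_0[OF char2])
  then have "B v e + 1 = 0" by simp
  then show ?thesis using two_eq_0(2)[OF char2, of 1] by (metis add_right_imp_eq)
qed

end

section \<open>Bases adapted to t\<close>

lemma independent_two:
  assumes "t v = e" "e \<noteq> 0"
  shows "distinct [e, v]" "independent {e, v}"
proof -
  show "distinct [e, v]" using assms t_unit by auto
  have "v \<notin> span {e}"
  proof
    assume "v \<in> span {e}"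
    then obtain k where "v = s k e" by (auto simp: span_singleton)
    then have "t v = 0" by (simp only: t_scale t_unit scale_zero_right)
    then show False using assms by simp
  qed
  then have "independent {v, e}"
    using assms(2) by (simp add: independent_insert)
  then show "independent {e, v}" by (simp add: insert_commute)
qed

text \<open>Since t kills e and x and sends v and y to e and x, applying t to a relation that
  involves v or y leaves one between e and x, which are independent.\<close>

lemma independent_four:
  assumes v: "t v = e" and "e \<noteq> 0" and x: "t x = 0" "x \<notin> span {e}" and y: "t y = x"
  shows "distinct [e, v, x, y]" "independent {e, v, x, y}"
proof -
  have vn: "v \<notin> span {x, e}"
  proof
    assume "v \<in> span {x, e}"
    then obtain k l where "v - s k x = s l e" by (auto simp: span_breakdown_eq span_singleton)
    then have "v = s l e + s k x" by (simp add: algebra_simps)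
    then show False using assms by (simp add: t_add t_scale t_unit)
  qed
  have yn: "y \<notin> span {v, x, e}"
  proof
    assume "y \<in> span {v, x, e}"
    then obtain j k l where "y - s j v - s k x = s l e" by (auto simp: span_breakdown_eq span_singleton)
    then have "y = s l e + s k x + s j v" by (simp add: algebra_simps)
    then have "x = s j e" using assms by (simp add: t_add t_scale t_unit)
    then show False using x(2) by (auto simp: span_singleton)
  qed
  show "distinct [e, v, x, y]"
    using vn yn x(2) span_base[of _ "{v, x, e}"] span_base[of _ "{x, e}"] span_base[of _ "{e}"] by auto
  have "independent {y, v, x, e}"
    using vn yn x(2) \<open>e \<noteq> 0\<close> by (simp add: independent_insert)
  then show "independent {e, v, x, y}" by (simp add: insert_commute)
qed

lemma independent_spans: "independent S \<Longrightarrow> card S = dim UNIV \<Longrightarrow> span S = UNIV"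
  using card_ge_dim_independent[of S UNIV] by auto

text \<open>If e spanned ker t, then t(u) = k e for every u, so u + k v would lie in ker t, and e
  and v would span everything.\<close>

lemma exists_second_kernel_element:
  assumes v: "t v = e" and e0: "e \<noteq> 0" and dim: "dim UNIV > 2"
  obtains x where "t x = 0" "x \<notin> span {e}" "B v x = 0"
proof -
  obtain a where a: "t a = 0" "a \<notin> span {e}"
  proof (rule ccontr)
    assume "\<not> thesis"
    with that have K: "t a = 0 \<Longrightarrow> a \<in> span {e}" for a by blast
    have "u \<in> span {e, v}" for u
    proof -
      obtain k where k: "t u = s k e" using K[of "t u"] by (auto simp: t_t span_singleton)
      then have "t (u + s k v) = 0" by (simp add: t_add t_scale v add_self)
      then obtain l where "u + s k v = s l e" using K by (auto simp: span_singleton)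
      then have "u = s l e + s k v" by (metis add.commute add_self(2))
      then show ?thesis by (simp add: span_add span_scale span_base)
    qed
    then have "dim UNIV \<le> card {e, v}" by (intro dim_le_card) auto
    also have "\<dots> \<le> 2" by (simp add: card_insert_if)
    finally show False using dim by simp
  qed
  \<comment> \<open>This multiple of e makes the sum orthogonal to v because B(v,e) = 1.\<close>
  have "a + s (B v a) e \<notin> span {e}"
  proof
    assume "a + s (B v a) e \<in> span {e}"
    then have "a + s (B v a) e - s (B v a) e \<in> span {e}"
      by (rule span_diff) (simp add: span_scale span_base)
    then show False using a(2) by simp
  qed
  then show thesis
    using that[of "a + s (B v a) e"] a(1)
    by (simp add: t_add t_scale t_unit B_right B_v_e[OF v e0] two_eq_0[OF char2])
qed

section \<open>Structure in dimensions 2 and 4\<close>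

theorem structure_dim_2:
  assumes "dim UNIV = 2"
  obtains v lam where "t v = e" "v \<cdot> v = s lam e" "distinct [e, v]" "independent {e, v}"
    "span {e, v} = UNIV" "B v v = 1" "B v e = 1" "B e e = 0"
proof -
  have e0: "e \<noteq> 0" using assms unit_nonzero by simp
  obtain v where v: "t v = e" using kernel[OF t_unit] by auto
  note ind = independent_two[OF v e0]
  have sp: "span {e, v} = UNIV" using ind assms by (intro independent_spans) auto
  have "v \<cdot> v \<in> span {v, e}" using sp by (simp add: insert_commute)
  then obtain k lam where "v \<cdot> v - s k v = s lam e" by (auto simp: span_breakdown_eq span_singleton)
  then have vv: "v \<cdot> v = s lam e + s k v" by (simp add: algebra_simps)
  \<comment> \<open>The square of v lies in ker t, so applying t isolates its v-coefficient.\<close>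
  then have "s k e = 0" using t_v_sq[OF v e0] by (simp add: t_add t_scale t_unit v)
  then have "v \<cdot> v = s lam e" using e0 vv by simp
  then show thesis
    using that v ind sp B_v_v[OF v e0] B_v_e[OF v e0] B_kernel[OF t_unit t_unit] by blast
qed

theorem structure_dim_4:
  assumes "dim UNIV = 4"
  obtains v lam x nu where "t v = e" "v \<cdot> v = s lam e" "t x = 0" "t (v \<cdot> x) = x" "nu \<noteq> 0"
    "distinct [e, v, x, v \<cdot> x]" "independent {e, v, x, v \<cdot> x}" "span {e, v, x, v \<cdot> x} = UNIV"
    "v \<cdot> (v \<cdot> x) = s (lam + 1) x" "x \<cdot> v = x + v \<cdot> x" "x \<cdot> x = s nu e"
    "x \<cdot> (v \<cdot> x) = s nu (v + e)" "v \<cdot> x \<cdot> v = s lam x + v \<cdot> x" "v \<cdot> x \<cdot> x = s nu v"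
    "v \<cdot> x \<cdot> (v \<cdot> x) = s nu v + s ((lam + 1) * nu) e"
    "B v v = 1" "B v e = 1" "B (v \<cdot> x) (v \<cdot> x) = nu" "B (v \<cdot> x) x = nu" "B e e = 0" "B e x = 0"
    "B e (v \<cdot> x) = 0" "B v x = 0" "B v (v \<cdot> x) = 0" "B x x = 0"
proof -
  have e0: "e \<noteq> 0" using assms unit_nonzero by simp
  obtain v0 where v0: "t v0 = e" using kernel[OF t_unit] by auto
  obtain x where x: "t x = 0" "x \<notin> span {e}" "B v0 x = 0"
    using exists_second_kernel_element[OF v0 e0] assms by auto
  \<comment> \<open>A provisional preimage of x: the final one, v x, must wait until v is corrected.
    \<open>nu\<close> is read off from w now and turns out to be B(v x, v x).\<close>
  obtain w where w: "t w = x" using kernel[OF x(1)] by auto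
  define nu where "nu = B w w"
  have bxx: "b \<cdot> x \<cdot> x = s nu b" for b unfolding nu_def by (rule kernel_mul_twice[OF w])
  have xx: "x \<cdot> x = s nu e" using bxx[of e] by (simp add: unit)
  have Bxe: "B x e = 0" and Bex: "B e x = 0" and Bee: "B e e = 0" and Bxx: "B x x = 0"
    using B_kernel x(1) t_unit by blast+
  \<comment> \<open>Stated for every admissible v because it serves both the provisional
    \<open>v0\<close> and the corrected \<open>v\<close>. The deformation term drops out since t(x)
    = 0.\<close>
  have xv: "x \<cdot> v = x + v \<cdot> x" if "t v = e" "B v x = 0" for v
    using mul_right_linearized[of e x v] that
    by (simp add: unit x(1) mul_zero B_v_e[OF that(1) e0] Bxe Bex B_sym[of x v] eq_iff_add_eq_0[of "x \<cdot> v"] add_ac)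
  obtain lam0 mu where v0v0: "v0 \<cdot> v0 = s lam0 e + s mu x"
  proof -
    have "span {e, v0, x, w} = UNIV"
      using independent_four[OF v0 e0 x(1,2) w] assms by (intro independent_spans) auto
    then have "v0 \<cdot> v0 \<in> span {w, v0, x, e}" by (simp add: insert_commute)
    then obtain i j k l where "v0 \<cdot> v0 - s i w - s j v0 - s k x = s l e"
      by (auto simp: span_breakdown_eq span_singleton)
    then have eq: "v0 \<cdot> v0 = s l e + s k x + s j v0 + s i w" by (simp add: algebra_simps)
    \<comment> \<open>The square of \<open>v0\<close> is killed by t, which sees only its
      \<open>v0\<close>- and w-coefficients; independence of e and x makes both 0.\<close>
    then have ij: "s j e + s i x = 0"
      using t_v_sq[OF v0 e0] by (simp add: t_add t_scale t_unit v0 x(1) w)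
    have "i = 0"
    proof (rule ccontr)
      assume "i \<noteq> 0"
      have "s i x = s j e" using ij by (simp add: eq_iff_add_eq_0[of "s i x"] add_ac)
      then have "s (inverse i) (s i x) = s (inverse i) (s j e)" by simp
      then have "x = s (inverse i * j) e" using \<open>i \<noteq> 0\<close> by simp
      then show False using x(2) by (auto simp: span_singleton)
    qed
    then have "j = 0" using ij e0 by simp
    then show thesis using that eq \<open>i = 0\<close> by simp
  qed
  text \<open>Replacing \<open>v\<^sub>0\<close> by \<open>v\<^sub>0 + \<mu>x\<close> kills the \<open>x\<close>-component of its square.\<close>
  define v where "v = v0 + s mu x"
  define lam where "lam = lam0 + mu\<^sup>2 * nu"
  have v: "t v = e" by (simp add: v_def t_add t_scale v0 x)
  have Bvx: "B v x = 0" by (simp add: v_def B_add B_scale x Bxx)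
  have "v \<cdot> v = s lam0 e + s mu x + s mu (x \<cdot> v0 + v0 \<cdot> x) + s (mu * (mu * nu)) e"
    by (simp add: v_def mul_add mul_scale v0v0 xx scale_right_distrib add_ac)
  \<comment> \<open>The mixed terms thus contribute a second \<open>mu\<close> x, which cancels the
    first; the square of \<open>mu\<close> x accounts for the passage from \<open>lam0\<close> to
    \<open>lam\<close>.\<close>
  also have "x \<cdot> v0 + v0 \<cdot> x = x"
    by (simp add: xv[OF v0 x(3)] add_ac add_self)
  finally have vv: "v \<cdot> v = s lam e"
    by (simp add: lam_def scale_left_distrib power2_eq_square add_ac add_self)
  define y where "y = v \<cdot> x"
  have ty: "t y = x" by (simp add: y_def t_mul v x unit mul_zero)
  note ind = independent_four[OF v e0 x(1,2) ty]
  have sp: "span {e, v, x, y} = UNIV" using ind assms by (intro independent_spans) auto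
  note Bve = B_v_e[OF v e0] and xv = xv[OF v Bvx, folded y_def]
  have yx: "y \<cdot> x = s nu v" unfolding y_def by (rule bxx)
  \<comment> \<open>The rest of the table comes from \<open>mul_right_linearized\<close>, the
    missing values of B from adjointness and \<open>B_mul\<close>. The order matters:
    \<open>vy\<close> uses \<open>yv\<close> and \<open>Byv\<close>, and \<open>yy\<close> uses
    \<open>vy\<close>.\<close>
  have yv: "y \<cdot> v = s lam x + y"
    using mul_right_linearized[of v x v]
    by (simp add: x(1) mul_zero Bve Bxe Bex B_sym[of x v] Bvx vv mul_scale unit eq_iff_add_eq_0[of "y \<cdot> v"] add_ac
        flip: y_def)
  have Byx: "B y x = nu"
    using B_mul_adjoint[of v x x] by (simp add: x(1) xx Bxe mul_zero B_right Bve flip: y_def)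
  have Bye: "B y e = 0"
    using B_mul_adjoint[of v x e] by (simp add: x(1) xx Bxe mul_zero B_right Bvx unit flip: y_def)
  have Byv: "B y v = 0"
    using B_mul[of v e x v]
    by (simp add: x(1) vv v unit t_unit mul_zero B_zero Bvx B_sym[of x] Bex B_scale flip: y_def)
  \<comment> \<open>For a = b = v and c = d = w the first four terms of \<open>B_mul\<close> cancel
    in pairs, and the last one is B(v t(w), v t(w)). So \<open>nu\<close> does not depend on the
    choice of w.\<close>
  have Byy: "B y y = nu"
    using B_mul[of v v w w]
    by (simp add: w B_v_v[OF v e0] add_ac two_eq_0[OF char2] nu_def flip: y_def)
  have vy: "v \<cdot> y = s (lam + 1) x"
    using mul_right_linearized[of e y v]
    by (simp add: v ty unit Bve Bye Byv B_sym[of v y] yv scale_left_distrib eq_iff_add_eq_0[of "v \<cdot> y"] add_ac add_self)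
  have "x \<cdot> y + s nu v = s nu e"
    using mul_right_linearized[of e x y] by (simp add: x(1) ty unit Bxe Bye Byx yx mul_zero)
  then have "x \<cdot> y = s nu e + s nu v" by (rule add_eq_iff[THEN iffD1])
  then have xy: "x \<cdot> y = s nu (v + e)" by (simp add: scale_right_distrib add_ac)
  have "y \<cdot> y + s ((lam + 1) * nu) e = s nu v"
    using mul_right_linearized[of v x y]
    by (simp add: x(1) ty unit Bxe Bye Byx vy xx mul_zero mul_scale add_ac flip: y_def)
  then have yy: "y \<cdot> y = s nu v + s ((lam + 1) * nu) e"
    by (rule add_eq_iff[THEN iffD1])
  \<comment> \<open>Among the basis vectors x pairs nontrivially at most with v x, where the value
    is \<open>nu\<close>; if that were 0, x would be in the radical of B.\<close>
  have "nu \<noteq> 0"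
  proof
    assume "nu = 0"
    have "subspace {u. B x u = 0}" by (auto simp: subspace_def B_zero B_right)
    then have "span {e, v, x, y} \<subseteq> {u. B x u = 0}"
      using \<open>nu = 0\<close> Byx by (intro span_minimal) (auto simp: Bxe Bxx Bvx B_sym[of x v] B_sym[of x y])
    then have "x = 0" using sp by (intro B_nondeg) auto
    then show False using x(2) by (simp add: span_zero)
  qed
  then show thesis
    using that[of v lam x nu] v vv x(1) ty ind sp vy xv xx xy yv yx yy B_v_v[OF v e0] Bve Byy Byx Bee Bex
      Bye Bvx Byv Bxx B_sym[of e y] B_sym[of v y]
    by (simp flip: y_def)
qed

end

section \<open>From quadratic forms on tensors to the locale\<close>

lemma unital_composition_algebra_locale:
  fixes U :: "('f::field, 'u::ab_group_add, 'm) ver4_alg_scheme"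
  assumes F: "CHAR('f) = 2" and uca: "unital_composition_algebra U Q e"
    and tw: "trivial_frobenius_twist U"
  shows "\<exists>Basis. twist_free_composition_algebra (scal U) Basis (tact U) (\<lambda>u v. u \<odot>\<^bsub>U\<^esub> v) e
    (assoc_bilinear U Q)"
proof -
  have A: "ver4_algebra U" and un: "is_unit U e" and qf: "quadratic_form U Q"
    and nd: "nondegenerate U Q" and mf: "multiplicative_form U Q"
    using uca by (simp_all add: unital_composition_algebra_def)
  have O: "ver4_object U" using A by (simp add: ver4_algebra_def)
  obtain Basis where "finite_dimensional_vector_space (scal U) Basis"
    using O unfolding ver4_object_def by blast
  then interpret finite_dimensional_vector_space "scal U" Basis .
  let ?S = "symmetrized_tensor U" and ?B = "assoc_bilinear U Q"
  note G = symmetrized_tensor_in_Gamma2[OF F O]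
  have Q_add: "Q (X + Y) = Q X + Q Y" if "X \<in> Gamma2 U" "Y \<in> Gamma2 U" for X Y
    using qf that by (simp add: quadratic_form_def ver4_hom_on_def)
  have Q_scale: "Q (tensor_scale c X) = c * Q X" and Q_t: "Q (tact (tensor_object U) X) = 0"
    if "X \<in> Gamma2 U" for c X
    using qf that by (simp_all add: quadratic_form_def ver4_hom_on_def unit_object_def tensor_object_def)
  note B = assoc_bilinear_eq[of U Q]
  have B_add: "?B (u + u') v = ?B u v + ?B u' v" "?B u (v + v') = ?B u v + ?B u v'" for u u' v v'
    by (simp_all add: B symmetrized_tensor_add[OF O] Q_add G)
  have B_scale: "?B (scal U c u) v = c * ?B u v" for c u v
    by (simp add: B symmetrized_tensor_scale[OF O] Q_scale G)
  \<comment> \<open>As t acts by 0 on the unit object, Q vanishes on t-images; on a symmetrized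
    tensor this says B(t(u),v) + B(u,t(v)) = 0.\<close>
  have B_t: "?B (tact U u) v = ?B u (tact U v)" for u v
  proof -
    have "?B (tact U u) v + ?B u (tact U v) = 0"
      using Q_t[OF G, of u v] by (simp add: B tact_symmetrized_tensor[OF O] Q_add G)
    then show ?thesis by (metis add_right_imp_eq two_eq_0(2)[OF F])
  qed
  have B_tt: "?B (tact U u) (tact U v) = 0" for u v
  proof -
    have "?B u 0 = ?B u 0 + ?B u 0" using B_add(2)[of u 0 0] by simp
    then show ?thesis by (simp add: B_t ver4_object_tact[OF O] two_eq_0[OF F])
  qed
  \<comment> \<open>Exchanging u and v changes \<open>?S u v\<close> by
    \<open>?S (tact U u) (tact U v)\<close>, on which Q vanishes by \<open>B_tt\<close>.\<close>
  have B_sym: "?B u v = ?B v u" for u v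
  proof -
    have "?S v u = ?S u v + ?S (tact U u) (tact U v)"
      by (simp add: symmetrized_tensor_def ver4_object_tact[OF O] tensor_add_self[OF F]
          pure_tensor_bilinear[OF ver4_objectD(1)[OF O]] add_ac)
    then show ?thesis using B_tt[of u v] by (simp add: B Q_add G)
  qed
  have bil: "bilinear_map (scal U) (scal U) (\<lambda>u v. u \<odot>\<^bsub>U\<^esub> v)" by (rule bilinear_alg_prod[OF A])
  have "twist_free_composition_algebra_axioms (scal U) (tact U) (\<lambda>u v. u \<odot>\<^bsub>U\<^esub> v) e ?B"
  proof
    show "?B a b * ?B c d = ?B (a \<odot>\<^bsub>U\<^esub> c) (b \<odot>\<^bsub>U\<^esub> d) + ?B (a \<odot>\<^bsub>U\<^esub> tact U c) (tact U b \<odot>\<^bsub>U\<^esub> d) +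
      ?B (a \<odot>\<^bsub>U\<^esub> d) (b \<odot>\<^bsub>U\<^esub> c) + ?B (a \<odot>\<^bsub>U\<^esub> tact U d) (tact U b \<odot>\<^bsub>U\<^esub> c) +
      ?B (a \<odot>\<^bsub>U\<^esub> tact U d) (b \<odot>\<^bsub>U\<^esub> tact U c)" for a b c d
    proof -
      have "?B a b * ?B c d = Q (tensor_mult U (?S a b) (?S c d))"
        using mf by (simp add: B multiplicative_form_def G)
      then show ?thesis
        by (simp add: tensor_mult_symmetrized[OF F A] B Q_add G Gamma2_add)
    qed
    show "u = 0" if "\<And>v. ?B u v = 0" for u using nd that by (simp add: nondegenerate_def)
    show "?B u v = ?B v u" for u v by (rule B_sym)
  qed (use F un bil in \<open>simp_all add: ver4_object_tact[OF O] trivial_frobenius_twist_kernel[OF O tw]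
      ver4_algebra_tact_prod[OF A] is_unit_def bilinear_map_alt B_add B_t B_scale\<close>)
  then show ?thesis
    using finite_dimensional_vector_space_axioms twist_free_composition_algebra.intro by blast
qed

section \<open>The model algebras\<close>

lemma alg_iso_inv:
  assumes "alg_iso A A' \<phi>"
  shows "alg_iso A' A (inv \<phi>)"
proof -
  have bij: "bij \<phi>" using assms by (simp add: alg_iso_def)
  have inv: "\<phi> (inv \<phi> x) = x" for x using bij by (simp add: bij_is_surj surj_f_inv_f)
  have cancel: "inv \<phi> x = y" if "x = \<phi> y" for x y using bij that by (simp add: bij_is_inj)
  have "bij (inv \<phi>)" using bij by (rule bij_imp_bij_inv)
  moreover have "ver4_hom_on UNIV A' A (inv \<phi>)"
    using assms unfolding ver4_hom_on_def alg_iso_def by (auto intro!: cancel simp: inv)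
  moreover have "inv \<phi> (u \<odot>\<^bsub>A'\<^esub> v) = inv \<phi> u \<odot>\<^bsub>A\<^esub> inv \<phi> v" for u v
    using assms unfolding alg_iso_def by (auto intro!: cancel simp: inv)
  ultimately show ?thesis by (simp add: alg_iso_def)
qed

text \<open>By surjectivity e' is the image of some u. The product of the image of e with e' is the
  former because e' is a right unit, and the image of u because e is a left unit.\<close>

lemma alg_iso_unit:
  assumes "alg_iso A A' \<phi>" "\<And>u. e \<odot>\<^bsub>A\<^esub> u = u" "\<And>u. u \<odot>\<^bsub>A'\<^esub> e' = u"
  shows "\<phi> e = e'"
proof -
  obtain u where u: "e' = \<phi> u" using assms(1) unfolding alg_iso_def bij_def surj_def by blast
  have "\<phi> e = \<phi> e \<odot>\<^bsub>A'\<^esub> \<phi> u" using assms(3) u by simp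
  also have "\<dots> = \<phi> (e \<odot>\<^bsub>A\<^esub> u)" using assms(1) by (simp add: alg_iso_def)
  finally show ?thesis using assms(2) u by simp
qed

lemma char2_diff_eq:
  assumes "CHAR('f::field) = 2"
  shows "(x::'f) - y = x + y"
  by (metis add_diff_cancel_right' add.assoc two_eq_0(2)[OF assms] add_0_right)

section \<open>Isomorphisms between model algebras\<close>

lemma alg_two_eqs:
  "scal (alg_two lam) = (*s)" "tact (alg_two lam) u = vector [u $ 2, 0]"
  "u \<odot>\<^bsub>alg_two lam\<^esub> v = vector [u $ 1 * v $ 1 + lam * (u $ 2 * v $ 2), u $ 1 * v $ 2 + u $ 2 * v $ 1]"
proof -
  have "vector [w $ 1, w $ 2] = w" for w :: "'a ^ 2" by (simp add: vec_eq_iff forall_2)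
  then show "u \<odot>\<^bsub>alg_two lam\<^esub> v =
      vector [u $ 1 * v $ 1 + lam * (u $ 2 * v $ 2), u $ 1 * v $ 2 + u $ 2 * v $ 1]"
    using prod_alg_two[of "u $ 1" "u $ 2" lam "v $ 1" "v $ 2"] by simp
qed (simp_all add: alg_two_def)

lemma alg_four_eqs:
  "scal (alg_four lam nu) = (*s)" "tact (alg_four lam nu) u = vector [u $ 2, 0, u $ 4, 0]"
  by (simp_all add: alg_four_def)

text \<open>An isomorphism fixes e and commutes with t, so it sends v to a e + v. The square of this
  element is (a^2 + \<open>lam'\<close>) e and must equal \<open>lam\<close> e.\<close>

lemma isomorphic_alg_two_iff:
  assumes F: "CHAR('f::field) = 2"
  shows "isomorphic (alg_two (lam::'f)) (alg_two lam') \<longleftrightarrow> (\<exists>a. lam' - lam = a\<^sup>2)"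
proof
  assume "isomorphic (alg_two lam) (alg_two lam')"
  then obtain \<phi> where \<phi>: "alg_iso (alg_two lam) (alg_two lam') \<phi>" by (auto simp: isomorphic_def)
  define e v :: "'f ^ 2" where "e = vector [1, 0]" and "v = vector [0, 1]"
  have e: "\<phi> e = e"
    by (rule alg_iso_unit[OF \<phi>]) (simp_all add: alg_two_eqs vec_eq_iff forall_2 e_def)
  have "tact (alg_two lam') (\<phi> v) = \<phi> (tact (alg_two lam) v)"
    using \<phi> by (simp add: alg_iso_def ver4_hom_on_def)
  also have "tact (alg_two lam) v = e" by (simp add: alg_two_eqs e_def v_def)
  finally have "tact (alg_two lam') (\<phi> v) = e" by (simp add: e)
  then have 2: "\<phi> v $ 2 = 1" by (simp add: alg_two_eqs e_def vec_eq_iff forall_2)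
  have "\<phi> v \<odot>\<^bsub>alg_two lam'\<^esub> \<phi> v = \<phi> (v \<odot>\<^bsub>alg_two lam\<^esub> v)" using \<phi> by (simp add: alg_iso_def)
  also have "v \<odot>\<^bsub>alg_two lam\<^esub> v = lam *s e" by (simp add: alg_two_eqs e_def v_def vec_eq_iff forall_2)
  also have "\<phi> (lam *s e) = lam *s e"
    using \<phi> e by (simp add: alg_iso_def ver4_hom_on_def alg_two_eqs)
  finally have "(\<phi> v $ 1)\<^sup>2 + lam' = lam"
    by (simp add: alg_two_eqs 2 e_def vec_eq_iff forall_2 power2_eq_square)
  then have "lam' - lam = (\<phi> v $ 1)\<^sup>2"
    by (auto simp: char2_diff_eq[OF F] two_eq_0[OF F] add_ac)
  then show "\<exists>a. lam' - lam = a\<^sup>2" ..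
next
  assume "\<exists>a. lam' - lam = a\<^sup>2"
  then obtain a where "lam' - lam = a\<^sup>2" ..
  then have lam': "lam' = lam + a * a" by (simp add: power2_eq_square algebra_simps)
  \<comment> \<open>The substitution of a e + v for v, an involution in characteristic 2.\<close>
  define \<phi> :: "'f ^ 2 \<Rightarrow> 'f ^ 2" where "\<phi> = (\<lambda>u. vector [u $ 1 + a * u $ 2, u $ 2])"
  have "bij \<phi>"
    by (rule involuntory_imp_bij) (simp add: \<phi>_def vec_eq_iff forall_2 two_eq_0[OF F] add.assoc)
  then have "alg_iso (alg_two lam) (alg_two lam') \<phi>"
    by (simp add: alg_iso_def ver4_hom_on_def alg_two_eqs \<phi>_def vec_eq_iff forall_2 lam'
        algebra_simps two_eq_0[OF F])
  then show "isomorphic (alg_two lam) (alg_two lam')" by (auto simp: isomorphic_def)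
qed

text \<open>Commutation with t gives images a e + v + r x + 0 v x of v and p e + q x of x. The
  relations between v and x then force p = r = 0, \<open>nu\<close> = q^2 \<open>nu'\<close> and
  \<open>lam\<close> = a^2 + \<open>lam'\<close>.\<close>

lemma isomorphic_alg_four_iff:
  assumes F: "CHAR('f::field) = 2" and nu: "nu \<noteq> 0" and nu': "nu' \<noteq> 0"
  shows "isomorphic (alg_four (lam::'f) nu) (alg_four lam' nu') \<longleftrightarrow>
    (\<exists>a. lam' - lam = a\<^sup>2) \<and> (\<exists>a. a \<noteq> 0 \<and> nu' * inverse nu = a\<^sup>2)"
proof
  assume "isomorphic (alg_four lam nu) (alg_four lam' nu')"
  then obtain \<phi> where \<phi>: "alg_iso (alg_four lam nu) (alg_four lam' nu') \<phi>" by (auto simp: isomorphic_def)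
  let ?A = "alg_four lam nu" and ?A' = "alg_four lam' nu'"
  have hom: "\<phi> (u + w) = \<phi> u + \<phi> w" "\<phi> (c *s u) = c *s \<phi> u" "tact ?A' (\<phi> u) = \<phi> (tact ?A u)"
    "\<phi> u \<odot>\<^bsub>?A'\<^esub> \<phi> w = \<phi> (u \<odot>\<^bsub>?A\<^esub> w)" for u w c
    using \<phi> by (simp_all add: alg_iso_def ver4_hom_on_def alg_four_eqs)
  define e v x :: "'f ^ 4" where "e = vector [1, 0, 0, 0]" and "v = vector [0, 1, 0, 0]"
    and "x = vector [0, 0, 1, 0]"
  have e: "\<phi> e = e"
    by (rule alg_iso_unit[OF \<phi>]) (simp_all add: prod_alg_four vec_eq_iff forall_4 e_def)
  have "tact ?A v = e" by (simp add: alg_four_eqs e_def v_def)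
  then have "tact ?A' (\<phi> v) = e" using hom(3)[of v] e by simp
  then have v24: "\<phi> v $ 2 = 1" "\<phi> v $ 4 = 0"
    by (simp_all add: alg_four_eqs e_def vec_eq_iff forall_4)
  have "tact ?A x = 0 *s e" by (simp add: alg_four_eqs x_def vec_eq_iff forall_4)
  then have "tact ?A' (\<phi> x) = 0 *s \<phi> e" by (simp only: hom)
  then have x24: "\<phi> x $ 2 = 0" "\<phi> x $ 4 = 0"
    by (simp_all add: alg_four_eqs vec_eq_iff forall_4)
  have vv: "v \<odot>\<^bsub>?A\<^esub> v = lam *s e" and xx: "x \<odot>\<^bsub>?A\<^esub> x = nu *s e"
    and xv: "x \<odot>\<^bsub>?A\<^esub> v = x + v \<odot>\<^bsub>?A\<^esub> x"
    by (simp_all add: prod_alg_four e_def v_def x_def vec_eq_iff forall_4)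
  \<comment> \<open>The two products of the images of x and v have equal e-coordinates, while their
    sum must be \<open>\<phi> x\<close>.\<close>
  have x1: "\<phi> x $ 1 = 0"
    using hom(4)[of x v] by (simp add: xv hom(1) flip: hom(4))
      (simp add: prod_alg_four vec_eq_iff forall_4 v24 x24 mult.commute)
  have nu_eq: "nu' * (\<phi> x $ 3)\<^sup>2 = nu"
    using hom(4)[of x x] by (simp add: xx hom(2) e)
      (simp add: prod_alg_four vec_eq_iff forall_4 x1 x24 e_def power2_eq_square)
  have vv': "\<phi> v \<odot>\<^bsub>?A'\<^esub> \<phi> v = lam *s e" using hom(4)[of v v] by (simp add: vv hom(2) e)
  \<comment> \<open>In the x-coordinate of the square of \<open>\<phi> v\<close> the two mixed terms
    with e cancel, which leaves \<open>\<phi> v $ 3\<close>; the square is a multiple of e.\<close>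
  then have v3: "\<phi> v $ 3 = 0"
    by (simp add: prod_alg_four vec_eq_iff forall_4 v24 e_def two_eq_0[OF F])
  have "(\<phi> v $ 1)\<^sup>2 + lam' = lam"
    using vv' by (simp add: prod_alg_four vec_eq_iff forall_4 v24 v3 e_def power2_eq_square)
  then have "lam' - lam = (\<phi> v $ 1)\<^sup>2"
    by (auto simp: char2_diff_eq[OF F] two_eq_0[OF F] add_ac)
  moreover have "inverse (\<phi> x $ 3) \<noteq> 0" "nu' * inverse nu = (inverse (\<phi> x $ 3))\<^sup>2"
    using nu_eq nu nu' by (auto simp: field_simps simp flip: nu_eq)
  ultimately show "(\<exists>a. lam' - lam = a\<^sup>2) \<and> (\<exists>a. a \<noteq> 0 \<and> nu' * inverse nu = a\<^sup>2)" by blast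
next
  assume "(\<exists>a. lam' - lam = a\<^sup>2) \<and> (\<exists>a. a \<noteq> 0 \<and> nu' * inverse nu = a\<^sup>2)"
  then obtain a d where "lam' - lam = a\<^sup>2" and d: "d \<noteq> 0" "nu' * inverse nu = d\<^sup>2" by blast
  then have lam': "lam' = lam + a * a" by (simp add: power2_eq_square algebra_simps)
  \<comment> \<open>Sending x to c x requires c^2 \<open>nu'\<close> = \<open>nu\<close>, so c is
    inverse to the square root d of the quotient of \<open>nu'\<close> by \<open>nu\<close>.\<close>
  define c where "c = inverse d"
  have c: "c \<noteq> 0" and nu_eq: "nu = c * (c * nu')"
    using d nu by (auto simp: c_def field_simps power2_eq_square)
  \<comment> \<open>Here v goes to a e + v and x to c x; multiplicativity then dictates the image c
    (a x + v x) of v x. The inverse \<open>\<psi>\<close> has the same shape, with c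
    inverted.\<close>
  define \<phi> :: "'f ^ 4 \<Rightarrow> 'f ^ 4"
    where "\<phi> = (\<lambda>u. vector [u $ 1 + a * u $ 2, u $ 2, c * (u $ 3 + a * u $ 4), c * u $ 4])"
  define \<psi> :: "'f ^ 4 \<Rightarrow> 'f ^ 4"
    where "\<psi> = (\<lambda>u. vector [u $ 1 + a * u $ 2, u $ 2, inverse c * (u $ 3 + a * u $ 4), inverse c * u $ 4])"
  have "bij \<phi>"
    by (rule o_bij[of \<psi>]) (simp_all add: \<phi>_def \<psi>_def vec_eq_iff forall_4 fun_eq_iff c
        algebra_simps two_eq_0[OF F])
  then have "alg_iso (alg_four lam nu) (alg_four lam' nu') \<phi>"
    by (simp add: alg_iso_def ver4_hom_on_def alg_four_eqs prod_alg_four \<phi>_def vec_eq_iff forall_4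
        lam' nu_eq algebra_simps two_eq_0[OF F])
  then show "isomorphic (alg_four lam nu) (alg_four lam' nu')" by (auto simp: isomorphic_def)
qed

section \<open>Coordinates with respect to a basis\<close>

context vector_space
begin

lemma independent_two_coords:
  assumes "distinct [a, b]" "independent {a, b}" "scale k a + scale l b = 0"
  shows "k = 0 \<and> l = 0"
proof -
  define f where "f = (\<lambda>z. if z = a then k else l)"
  have "(\<Sum>z\<in>{a, b}. scale (f z) z) = 0" using assms by (auto simp: f_def)
  then have "f z = 0" if "z \<in> {a, b}" for z
    using assms(2) that unfolding dependent_finite[of "{a, b}", simplified] by blast
  from this[of a] this[of b] show ?thesis using assms(1) by (auto simp: f_def)
qed

lemma independent_four_coords:
  assumes "distinct [a, b, c, d]" "independent {a, b, c, d}"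
    "scale k a + scale l b + scale m c + scale n d = 0"
  shows "k = 0 \<and> l = 0 \<and> m = 0 \<and> n = 0"
proof -
  define f where "f = (\<lambda>z. if z = a then k else if z = b then l else if z = c then m else n)"
  have "(\<Sum>z\<in>{a, b, c, d}. scale (f z) z) = 0" using assms by (auto simp: f_def add.assoc)
  then have "f z = 0" if "z \<in> {a, b, c, d}" for z
    using assms(2) that unfolding dependent_finite[of "{a, b, c, d}", simplified] by blast
  from this[of a] this[of b] this[of c] this[of d] show ?thesis using assms(1) by (auto simp: f_def)
qed

end

text \<open>The map out of the model is explicit in coordinates, and by bilinearity its
  multiplicativity reduces to products of basis vectors. It is built in that direction and then
  inverted.\<close>

lemma alg_iso_alg_two:
  fixes A :: "('f::field, 'u::ab_group_add, 'm) ver4_alg_scheme"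
  assumes A: "ver4_algebra A"
    and basis: "is_basis A [e, v]"
    and unit: "\<And>u. e \<odot>\<^bsub>A\<^esub> u = u" "\<And>u. u \<odot>\<^bsub>A\<^esub> e = u"
    and t: "tact A e = 0" "tact A v = e" and vv: "v \<odot>\<^bsub>A\<^esub> v = scal A lam e"
  shows "\<exists>\<phi>. alg_iso A (alg_two lam) \<phi> \<and> \<phi> e = axis 1 1 \<and> \<phi> v = axis 2 1"
proof -
  have O: "ver4_object A" using A by (simp add: ver4_algebra_def)
  interpret vector_space "scal A" by (rule ver4_objectD(1)[OF O])
  have prod: "(u + u') \<odot>\<^bsub>A\<^esub> w = u \<odot>\<^bsub>A\<^esub> w + u' \<odot>\<^bsub>A\<^esub> w" "u \<odot>\<^bsub>A\<^esub> (w + w') = u \<odot>\<^bsub>A\<^esub> w + u \<odot>\<^bsub>A\<^esub> w'"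
    "scal A c u \<odot>\<^bsub>A\<^esub> w = scal A c (u \<odot>\<^bsub>A\<^esub> w)" "u \<odot>\<^bsub>A\<^esub> scal A c w = scal A c (u \<odot>\<^bsub>A\<^esub> w)"
    for u u' w w' c
    using bilinear_alg_prod[OF A] unfolding bilinear_map_alt by blast+
  define \<psi> where "\<psi> = (\<lambda>u :: 'f ^ 2. scal A (u $ 1) e + scal A (u $ 2) v)"
  have "bij \<psi>"
  proof (rule bijI)
    show "inj \<psi>"
    proof (rule injI)
      fix a b assume "\<psi> a = \<psi> b"
      then have "scal A (a $ 1 - b $ 1) e + scal A (a $ 2 - b $ 2) v = 0"
        by (simp add: \<psi>_def scale_left_diff_distrib algebra_simps)
      then have "a $ 1 - b $ 1 = 0 \<and> a $ 2 - b $ 2 = 0"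
        using basis by (intro independent_two_coords) (auto simp: is_basis_def)
      then show "a = b" by (simp add: vec_eq_iff forall_2)
    qed
    show "surj \<psi>"
    unfolding surj_def
    proof
      fix u
      have "u \<in> span {v, e}" using basis by (simp add: is_basis_def insert_commute)
      then obtain k l where "u - scal A k v = scal A l e" by (auto simp: span_breakdown_eq span_singleton)
      then have "u = \<psi> (vector [l, k])" by (simp add: \<psi>_def algebra_simps)
      then show "\<exists>a. u = \<psi> a" by blast
    qed
  qed
  then have iso: "alg_iso (alg_two lam) A \<psi>"
    by (simp add: alg_iso_def ver4_hom_on_def alg_two_eqs \<psi>_def prod unit vv ver4_object_tact[OF O] t
        scale_left_distrib scale_right_distrib add_ac mult_ac)
  have "\<psi> (axis 1 1) = e" "\<psi> (axis 2 1) = v" by (simp_all add: \<psi>_def axis_def)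
  then have "inv \<psi> e = axis 1 1" "inv \<psi> v = axis 2 1"
    using \<open>bij \<psi>\<close> by (metis bij_is_inj inv_f_f)+
  then show ?thesis using alg_iso_inv[OF iso] by blast
qed

text \<open>Again the map out of the model is inverted; the unit laws and the nine products in
  \<open>table\<close> determine all products.\<close>

lemma alg_iso_alg_four:
  fixes A :: "('f::field, 'u::ab_group_add, 'm) ver4_alg_scheme"
  assumes A: "ver4_algebra A"
    and basis: "is_basis A [e, v, x, y]"
    and unit: "\<And>u. e \<odot>\<^bsub>A\<^esub> u = u" "\<And>u. u \<odot>\<^bsub>A\<^esub> e = u"
    and t: "tact A e = 0" "tact A v = e" "tact A x = 0" "tact A y = x"
    and table: "v \<odot>\<^bsub>A\<^esub> v = scal A lam e" "v \<odot>\<^bsub>A\<^esub> x = y" "v \<odot>\<^bsub>A\<^esub> y = scal A (lam + 1) x"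
      "x \<odot>\<^bsub>A\<^esub> v = x + y" "x \<odot>\<^bsub>A\<^esub> x = scal A nu e" "x \<odot>\<^bsub>A\<^esub> y = scal A nu (v + e)"
      "y \<odot>\<^bsub>A\<^esub> v = scal A lam x + y" "y \<odot>\<^bsub>A\<^esub> x = scal A nu v"
      "y \<odot>\<^bsub>A\<^esub> y = scal A nu v + scal A ((lam + 1) * nu) e"
  shows "\<exists>\<phi>. alg_iso A (alg_four lam nu) \<phi> \<and>
    \<phi> e = axis 1 1 \<and> \<phi> v = axis 2 1 \<and> \<phi> x = axis 3 1 \<and> \<phi> y = axis 4 1"
proof -
  have O: "ver4_object A" using A by (simp add: ver4_algebra_def)
  interpret vector_space "scal A" by (rule ver4_objectD(1)[OF O])
  have prod: "(u + u') \<odot>\<^bsub>A\<^esub> w = u \<odot>\<^bsub>A\<^esub> w + u' \<odot>\<^bsub>A\<^esub> w" "u \<odot>\<^bsub>A\<^esub> (w + w') = u \<odot>\<^bsub>A\<^esub> w + u \<odot>\<^bsub>A\<^esub> w'"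
    "scal A c u \<odot>\<^bsub>A\<^esub> w = scal A c (u \<odot>\<^bsub>A\<^esub> w)" "u \<odot>\<^bsub>A\<^esub> scal A c w = scal A c (u \<odot>\<^bsub>A\<^esub> w)"
    for u u' w w' c
    using bilinear_alg_prod[OF A] unfolding bilinear_map_alt by blast+
  define \<psi> where "\<psi> = (\<lambda>u :: 'f ^ 4.
    scal A (u $ 1) e + scal A (u $ 2) v + scal A (u $ 3) x + scal A (u $ 4) y)"
  have "bij \<psi>"
  proof (rule bijI)
    show "inj \<psi>"
    proof (rule injI)
      fix a b assume "\<psi> a = \<psi> b"
      then have "scal A (a $ 1 - b $ 1) e + scal A (a $ 2 - b $ 2) v +
        scal A (a $ 3 - b $ 3) x + scal A (a $ 4 - b $ 4) y = 0"
        by (simp add: \<psi>_def scale_left_diff_distrib algebra_simps)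
      then have "a $ 1 - b $ 1 = 0 \<and> a $ 2 - b $ 2 = 0 \<and> a $ 3 - b $ 3 = 0 \<and> a $ 4 - b $ 4 = 0"
        using basis by (intro independent_four_coords) (auto simp: is_basis_def)
      then show "a = b" by (simp add: vec_eq_iff forall_4)
    qed
    show "surj \<psi>"
    unfolding surj_def
    proof
      fix u
      have "u \<in> span {y, x, v, e}" using basis by (simp add: is_basis_def insert_commute)
      then obtain i j k l where "u - scal A i y - scal A j x - scal A k v = scal A l e"
        by (auto simp: span_breakdown_eq span_singleton)
      then have "u = \<psi> (vector [l, k, j, i])" by (simp add: \<psi>_def algebra_simps)
      then show "\<exists>a. u = \<psi> a" by blast
    qed
  qed
  then have iso: "alg_iso (alg_four lam nu) A \<psi>"
    by (simp add: alg_iso_def ver4_hom_on_def alg_four_eqs prod_alg_four \<psi>_def prod unit table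
        ver4_object_tact[OF O] t scale_left_distrib scale_right_distrib distrib_left distrib_right add_ac mult_ac)
  have "\<psi> (axis 1 1) = e" "\<psi> (axis 2 1) = v" "\<psi> (axis 3 1) = x" "\<psi> (axis 4 1) = y"
    by (simp_all add: \<psi>_def axis_def)
  then have "inv \<psi> e = axis 1 1" "inv \<psi> v = axis 2 1" "inv \<psi> x = axis 3 1" "inv \<psi> y = axis 4 1"
    using \<open>bij \<psi>\<close> by (metis bij_is_inj inv_f_f)+
  then show ?thesis using alg_iso_inv[OF iso] by blast
qed

section \<open>The classification, assembled from the structure theorems and the isomorphism
  criteria\<close>

theorem theorem5p13:
  assumes char2: "CHAR('f::field) = 2"
  shows
    "(\<forall>(U :: ('f, 'u::ab_group_add) ver4_alg) (Q :: ('f, 'u) tensor \<Rightarrow> 'f) (e :: 'u).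
        unital_composition_algebra U Q e \<and> trivial_frobenius_twist U \<and>
        vector_space.dim (scal U) UNIV = 2 \<longrightarrow>
        (\<exists>v lam.
           tact U v = e \<and> v \<odot>\<^bsub>U\<^esub> v = scal U lam e \<and>
           is_basis U [e, v] \<and>
           assoc_bilinear U Q v v = 1 \<and> assoc_bilinear U Q v e = 1 \<and>
           assoc_bilinear U Q e e = 0 \<and>
           (\<exists>\<phi>. alg_iso U (alg_two lam) \<phi> \<and> \<phi> e = axis 1 1 \<and> \<phi> v = axis 2 1))) \<and>
     (\<forall>lam lam' :: 'f.
        isomorphic (alg_two lam) (alg_two lam') \<longleftrightarrow> (\<exists>a. lam' - lam = a\<^sup>2)) \<and>
     (\<forall>(U :: ('f, 'u) ver4_alg) (Q :: ('f, 'u) tensor \<Rightarrow> 'f) (e :: 'u).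
        unital_composition_algebra U Q e \<and> trivial_frobenius_twist U \<and>
        vector_space.dim (scal U) UNIV = 4 \<longrightarrow>
        (\<exists>v lam x nu. let vx = v \<odot>\<^bsub>U\<^esub> x; B = assoc_bilinear U Q in
           tact U v = e \<and> v \<odot>\<^bsub>U\<^esub> v = scal U lam e \<and>
           x \<in> range (tact U) \<and> B v x = 0 \<and> nu \<noteq> 0 \<and>
           is_basis U [e, v, x, vx] \<and>
           v \<odot>\<^bsub>U\<^esub> vx = scal U (lam + 1) x \<and>
           x \<odot>\<^bsub>U\<^esub> v = x + vx \<and>
           x \<odot>\<^bsub>U\<^esub> x = scal U nu e \<and>
           x \<odot>\<^bsub>U\<^esub> vx = scal U nu (v + e) \<and>
           vx \<odot>\<^bsub>U\<^esub> v = scal U lam x + vx \<and>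
           vx \<odot>\<^bsub>U\<^esub> x = scal U nu v \<and>
           vx \<odot>\<^bsub>U\<^esub> vx = scal U nu v + scal U ((lam + 1) * nu) e \<and>
           (\<forall>u w. B u w = B w u) \<and>
           B v v = 1 \<and> B v e = 1 \<and> B vx vx = nu \<and> B vx x = nu \<and>
           B e e = 0 \<and> B e x = 0 \<and> B e vx = 0 \<and> B v x = 0 \<and> B v vx = 0 \<and> B x x = 0 \<and>
           (\<exists>\<phi>. alg_iso U (alg_four lam nu) \<phi> \<and>
              \<phi> e = axis 1 1 \<and> \<phi> v = axis 2 1 \<and> \<phi> x = axis 3 1 \<and> \<phi> vx = axis 4 1))) \<and>
     (\<forall>lam nu lam' nu' :: 'f. nu \<noteq> 0 \<and> nu' \<noteq> 0 \<longrightarrow>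
        (isomorphic (alg_four lam nu) (alg_four lam' nu') \<longleftrightarrow>
           (\<exists>a. lam' - lam = a\<^sup>2) \<and> (\<exists>a. a \<noteq> 0 \<and> nu' * inverse nu = a\<^sup>2)))"
proof (intro conjI allI impI)
  fix U :: "('f, 'u) ver4_alg" and Q :: "('f, 'u) tensor \<Rightarrow> 'f" and e :: 'u
  assume *: "unital_composition_algebra U Q e \<and> trivial_frobenius_twist U \<and>
    vector_space.dim (scal U) UNIV = 2"
  then obtain Basis where
    "twist_free_composition_algebra (scal U) Basis (tact U) (\<lambda>u v. u \<odot>\<^bsub>U\<^esub> v) e (assoc_bilinear U Q)"
    using unital_composition_algebra_locale[OF char2, of U Q e] by blast
  then interpret twist_free_composition_algebra "scal U" Basis "tact U" "\<lambda>u v. u \<odot>\<^bsub>U\<^esub> v" e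
    "assoc_bilinear U Q" .
  have A: "ver4_algebra U" using * by (simp add: unital_composition_algebra_def)
  obtain v lam where v: "tact U v = e" "v \<odot>\<^bsub>U\<^esub> v = scal U lam e" "distinct [e, v]" "independent {e, v}"
    "span {e, v} = UNIV" "assoc_bilinear U Q v v = 1" "assoc_bilinear U Q v e = 1"
    "assoc_bilinear U Q e e = 0"
    using structure_dim_2 * by blast
  have b: "is_basis U [e, v]" using v by (simp add: is_basis_def)
  show "\<exists>v lam. tact U v = e \<and> v \<odot>\<^bsub>U\<^esub> v = scal U lam e \<and> is_basis U [e, v] \<and>
      assoc_bilinear U Q v v = 1 \<and> assoc_bilinear U Q v e = 1 \<and> assoc_bilinear U Q e e = 0 \<and>
      (\<exists>\<phi>. alg_iso U (alg_two lam) \<phi> \<and> \<phi> e = axis 1 1 \<and> \<phi> v = axis 2 1)"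
    using v b alg_iso_alg_two[OF A b unit t_unit v(1,2)] by blast
next
  fix U :: "('f, 'u) ver4_alg" and Q :: "('f, 'u) tensor \<Rightarrow> 'f" and e :: 'u
  assume *: "unital_composition_algebra U Q e \<and> trivial_frobenius_twist U \<and>
    vector_space.dim (scal U) UNIV = 4"
  then obtain Basis where
    "twist_free_composition_algebra (scal U) Basis (tact U) (\<lambda>u v. u \<odot>\<^bsub>U\<^esub> v) e (assoc_bilinear U Q)"
    using unital_composition_algebra_locale[OF char2, of U Q e] by blast
  then interpret twist_free_composition_algebra "scal U" Basis "tact U" "\<lambda>u v. u \<odot>\<^bsub>U\<^esub> v" e
    "assoc_bilinear U Q" .
  have A: "ver4_algebra U" and dim: "dim UNIV = 4" using * by (simp_all add: unital_composition_algebra_def)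
  show "\<exists>v lam x nu. let vx = v \<odot>\<^bsub>U\<^esub> x; B = assoc_bilinear U Q in
           tact U v = e \<and> v \<odot>\<^bsub>U\<^esub> v = scal U lam e \<and>
           x \<in> range (tact U) \<and> B v x = 0 \<and> nu \<noteq> 0 \<and>
           is_basis U [e, v, x, vx] \<and>
           v \<odot>\<^bsub>U\<^esub> vx = scal U (lam + 1) x \<and>
           x \<odot>\<^bsub>U\<^esub> v = x + vx \<and>
           x \<odot>\<^bsub>U\<^esub> x = scal U nu e \<and>
           x \<odot>\<^bsub>U\<^esub> vx = scal U nu (v + e) \<and>
           vx \<odot>\<^bsub>U\<^esub> v = scal U lam x + vx \<and>
           vx \<odot>\<^bsub>U\<^esub> x = scal U nu v \<and>
           vx \<odot>\<^bsub>U\<^esub> vx = scal U nu v + scal U ((lam + 1) * nu) e \<and>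
           (\<forall>u w. B u w = B w u) \<and>
           B v v = 1 \<and> B v e = 1 \<and> B vx vx = nu \<and> B vx x = nu \<and>
           B e e = 0 \<and> B e x = 0 \<and> B e vx = 0 \<and> B v x = 0 \<and> B v vx = 0 \<and> B x x = 0 \<and>
           (\<exists>\<phi>. alg_iso U (alg_four lam nu) \<phi> \<and>
              \<phi> e = axis 1 1 \<and> \<phi> v = axis 2 1 \<and> \<phi> x = axis 3 1 \<and> \<phi> vx = axis 4 1)"
  proof (rule structure_dim_4[OF dim])
    fix v lam x nu
    let ?y = "v \<odot>\<^bsub>U\<^esub> x" and ?B = "assoc_bilinear U Q"
    assume v: "tact U v = e" "v \<odot>\<^bsub>U\<^esub> v = scal U lam e" "tact U x = 0" "tact U ?y = x" "nu \<noteq> 0"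
      and ind: "distinct [e, v, x, ?y]" "independent {e, v, x, ?y}" "span {e, v, x, ?y} = UNIV"
      and table: "v \<odot>\<^bsub>U\<^esub> ?y = scal U (lam + 1) x" "x \<odot>\<^bsub>U\<^esub> v = x + ?y" "x \<odot>\<^bsub>U\<^esub> x = scal U nu e"
        "x \<odot>\<^bsub>U\<^esub> ?y = scal U nu (v + e)" "?y \<odot>\<^bsub>U\<^esub> v = scal U lam x + ?y" "?y \<odot>\<^bsub>U\<^esub> x = scal U nu v"
        "?y \<odot>\<^bsub>U\<^esub> ?y = scal U nu v + scal U ((lam + 1) * nu) e"
      and B: "?B v v = 1" "?B v e = 1" "?B ?y ?y = nu" "?B ?y x = nu" "?B e e = 0" "?B e x = 0"
        "?B e ?y = 0" "?B v x = 0" "?B v ?y = 0" "?B x x = 0"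
    have b: "is_basis U [e, v, x, ?y]" using ind by (simp add: is_basis_def)
    have "x \<in> range (tact U)" "\<forall>u w. ?B u w = ?B w u" using kernel[OF v(3)] B_sym by blast+
    with v b table B alg_iso_alg_four[OF A b unit t_unit v(1,3,4,2) refl table]
    show ?thesis
      unfolding Let_def by (intro exI[of _ v] exI[of _ lam] exI[of _ x] exI[of _ nu] conjI)
  qed
next
  show "isomorphic (alg_two lam) (alg_two lam') \<longleftrightarrow> (\<exists>a. lam' - lam = a\<^sup>2)" for lam lam' :: 'f
    by (rule isomorphic_alg_two_iff[OF char2])
next
  show "isomorphic (alg_four lam nu) (alg_four lam' nu') \<longleftrightarrow>
      (\<exists>a. lam' - lam = a\<^sup>2) \<and> (\<exists>a. a \<noteq> 0 \<and> nu' * inverse nu = a\<^sup>2)"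
    if "nu \<noteq> 0 \<and> nu' \<noteq> 0" for lam nu lam' nu' :: 'f
    using that by (intro isomorphic_alg_four_iff[OF char2]) auto
qed

end
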